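(* Let $E$ be a real vector space of dimension $2$, $D\subset P(E)\times P(E)$ nonempty and open, and $B:D\to P(E)$ a map satisfying the following seven hypotheses: (H1) $(p,q)\in D\Rightarrow(q,p)\in D$; (H2) $(p,q),(r,s)\in D\Rightarrow(p,r)\in D$; (H3) $B(p,q)=B(q,p)$ for all $(p,q)\in D$; (H4) $p\ne B(p,q)\ne q$ for all $(p,q)\in D$ with $p\ne q$; (H5) denoting, for $(p,q)\in D$ with $p\neq q$, by $|p,q|$ the closed arc of $P(E)$ of extremities $p$ and $q$ characterized by $B(p,q)\in\mathrm{int}\,|p,q|$: for all $(p,q)\in D$ with $p\ne q$ and all $r,s\in\mathrm{int}\,|p,q|$ with $r\neq s$ we have $(r,s)\in D$ and $|r,s|\subset|p,q|$; (H6) $[B(p,q),B(p,r),B(p,s),B(r,s)]=[B(p,q),B(q,r),B(q,s),B(r,s)]$ whenever both sides are in the case of existence $C_0\cap C_\infty$; (H7) $B$ is continuous on $D$. Then the following hold: (C1) $(p,q)\in D\Rightarrow(p,p),(q,q)\in D$; (C2) $(q,q)\in D\Rightarrow B(q,q)=q$; (C3) there exists a nonempty, open and connected $U\subset P(E)$ such that $D=U\times U$ and $|p,q|\subset U$ for all $p,q\in U$, $p\ne q$; (C4) for all $p\in U$, $B(p,\cdot):U\to P(E)$ is injective; (C5) $U\neq P(E)$; (C6) for all $p\in U$, $B(p,U)\subset U$ and $B(p,\cdot)$ is orientation preserving on $U$; (C7) with $r_q(a,b,c):=[B(a,c),B(b,c),B(a,b),q]$, one has $$r_q(a,b,d)\,r_q(b,c,d)=r_q(a,c,d)$$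 in the sense that if both factors on the left are defined in the case $C_\infty$ (respectively $C_0$), then the right term is defined in the same case $C_\infty$ (respectively $C_0$) and the equality holds; (C8) the difference $d_q(x,y;u,v):=r_q(u,x,v)-r_q(u,y,v)$ verifies $$d_q(x,y;u,v)\,d_q(u,v;w,z)=d_q(x,y;w,z)$$ for $u\ne v$, $w\neq z$, $B(u,v)\ne q\ne B(w,z)$; (C9) for $x\neq y$, $u\ne v$, $\{B(x,y),B(u,v)\}\cap\{p,q\}=\emptyset$ we have $$\frac{d_p(x,y;u,v)}{d_q(x,y;u,v)}=[B(x,y),B(u,v),p,q].$$
   Context: $P(E)$ is the projective line of $E$ (the set of points $P(L)$, $L\subset E$ a 1-dimensional subspace), topologically a circle. The cross-ratio $[\cdot,\cdot,\cdot,\cdot]$ of four points of $P(E)$ is determined by $[P(\mathbf R(e_1+xe_2)),P(\mathbf R(e_1+e_2)),P(\mathbf Re_1),P(\mathbf Re_2)]=x$ for all $x\in\mathbf R$ and all linearly independent $e_1,e_2\in E$, extended to the maximal domain of definition and continuity $\underline D\subset P(E)^4$ as a map $\underline c:\underline D\to\mathbf R_\infty$, $\underline c(a,b,c,d)=[a,b,c,d]$, where $\mathbf R_\infty=\mathbf R\cup\{\infty\}$ is the one-point compactification; $(a,b,c,d)\in\underline D$ if and only if no three of the four entries coincide. Put $C_1=\underline D\setminus\underline c^{-1}(\{1\})$, $C_0=\underline D\setminus\underline c^{-1}(\{0\})$, $C_\infty=\underline D\setminus\underline c^{-1}(\{\infty\})$; a cross-ratio is said to be defined "in the case $C_i$"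 if its quadruple lies in $C_i$. In (H6) the points $p,q,r,s$ are such that the values of $B$ which occur are defined (the relevant pairs are in $D$). In (C7)–(C9), the arguments $a,b,c,d,x,y,u,v,w,z$ of $r$ and $d$ are points of $U$, while the lower indices $p,q$ are points of $P(E)$. *)

theory Defs
  imports "HOL-Analysis.Analysis"
begin

text \<open>The plane \<open>E\<close> is a whole type \<open>'a :: real_vector\<close>; the theorem assumes \<open>dim UNIV = 2\<close>, and the
  two topologies below are the intended ones only in that case. A point of the projective line is
  identified with the 1-dimensional subspace that it represents.\<close>

definition lin_indep2 :: "'a::real_vector \<Rightarrow> 'a \<Rightarrow> bool" where
  "lin_indep2 e1 e2 \<longleftrightarrow> e1 \<noteq> e2 \<and> independent {e1, e2}"

definition proj_line :: "'a::real_vector set set" where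
  "proj_line = {L. subspace L \<and> dim L = 1}"

definition proj_pt :: "'a::real_vector \<Rightarrow> 'a set" where
  "proj_pt v = span {v}"

text \<open>The canonical topology of a real plane: the one transported from \<open>\<real>\<^sup>2\<close> by any basis.\<close>

definition plane_open :: "'a::real_vector set \<Rightarrow> bool" where
  "plane_open S \<longleftrightarrow>
     (\<forall>e1 e2. lin_indep2 e1 e2 \<longrightarrow> open {(x::real, y::real). x *\<^sub>R e1 + y *\<^sub>R e2 \<in> S})"

definition plane_topology :: "'a::real_vector topology" where
  "plane_topology = topology plane_open"

text \<open>The quotient topology for \<open>v \<mapsto> proj_pt v\<close> on \<open>E - {0}\<close>.\<close>

definition proj_open :: "'a::real_vector set set \<Rightarrow> bool" where
  "proj_open S \<longleftrightarrow>
     S \<subseteq> proj_line \<and> openin plane_topology {v. v \<noteq> 0 \<and> proj_pt v \<in> S}"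

definition proj_topology :: "'a::real_vector set topology" where
  "proj_topology = topology proj_open"

lemma istopology_plane_open: "istopology plane_open"
proof -
  have "plane_open (S \<inter> T)" if S: "plane_open S" and T: "plane_open T" for S T :: "'a set"
    unfolding plane_open_def
  proof (intro allI impI)
    fix e1 e2 :: 'a
    assume e: "lin_indep2 e1 e2"
    have "open ({(x::real, y::real). x *\<^sub>R e1 + y *\<^sub>R e2 \<in> S} \<inter>
                {(x::real, y::real). x *\<^sub>R e1 + y *\<^sub>R e2 \<in> T})"
      using S[unfolded plane_open_def, rule_format, OF e]
            T[unfolded plane_open_def, rule_format, OF e] by (rule open_Int)
    moreover have "{(x::real, y::real). x *\<^sub>R e1 + y *\<^sub>R e2 \<in> S} \<inter>
                   {(x::real, y::real). x *\<^sub>R e1 + y *\<^sub>R e2 \<in> T} =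
                   {(x, y). x *\<^sub>R e1 + y *\<^sub>R e2 \<in> S \<inter> T}"
      by blast
    ultimately show "open {(x::real, y::real). x *\<^sub>R e1 + y *\<^sub>R e2 \<in> S \<inter> T}"
      by (simp only:)
  qed
  moreover have "plane_open (\<Union>K)" if K: "\<forall>S\<in>K. plane_open S" for K :: "'a set set"
    unfolding plane_open_def
  proof (intro allI impI)
    fix e1 e2 :: 'a
    assume e: "lin_indep2 e1 e2"
    have "open (\<Union>S\<in>K. {(x::real, y::real). x *\<^sub>R e1 + y *\<^sub>R e2 \<in> S})"
    proof (rule open_UN, rule ballI)
      fix S assume "S \<in> K"
      then have "plane_open S" using K by blast
      from this[unfolded plane_open_def, rule_format, OF e]
      show "open {(x::real, y::real). x *\<^sub>R e1 + y *\<^sub>R e2 \<in> S}" .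
    qed
    moreover have "(\<Union>S\<in>K. {(x::real, y::real). x *\<^sub>R e1 + y *\<^sub>R e2 \<in> S}) =
                   {(x, y). x *\<^sub>R e1 + y *\<^sub>R e2 \<in> \<Union>K}"
      by blast
    ultimately show "open {(x::real, y::real). x *\<^sub>R e1 + y *\<^sub>R e2 \<in> \<Union>K}"
      by (simp only:)
  qed
  ultimately show ?thesis
    unfolding istopology_def by blast
qed

lemma openin_plane_topology: "openin plane_topology S \<longleftrightarrow> plane_open S"
  unfolding plane_topology_def topology_inverse'[OF istopology_plane_open] ..

lemma istopology_proj_open: "istopology proj_open"
proof -
  have "proj_open (S \<inter> T)" if S: "proj_open S" and T: "proj_open T" for S T :: "'a set set"
  proof -
    have "{v. v \<noteq> 0 \<and> proj_pt v \<in> S \<inter> T} =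
          {v. v \<noteq> 0 \<and> proj_pt v \<in> S} \<inter> {v. v \<noteq> 0 \<and> proj_pt v \<in> T}"
      by blast
    moreover have "openin plane_topology
          ({v. v \<noteq> 0 \<and> proj_pt v \<in> S} \<inter> {v. v \<noteq> 0 \<and> proj_pt v \<in> T})"
      using S T unfolding proj_open_def by (intro openin_Int) auto
    moreover have "S \<inter> T \<subseteq> proj_line"
      using S unfolding proj_open_def by blast
    ultimately show ?thesis
      unfolding proj_open_def by (simp only: simp_thms)
  qed
  moreover have "proj_open (\<Union>K)" if K: "\<forall>S\<in>K. proj_open S" for K :: "'a set set set"
  proof -
    have "{v. v \<noteq> 0 \<and> proj_pt v \<in> \<Union>K} = \<Union>((\<lambda>S. {v. v \<noteq> 0 \<and> proj_pt v \<in> S}) ` K)"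
      by blast
    moreover have "openin plane_topology (\<Union>((\<lambda>S. {v. v \<noteq> 0 \<and> proj_pt v \<in> S}) ` K))"
      using K unfolding proj_open_def by (intro openin_Union) blast
    moreover have "\<Union>K \<subseteq> proj_line"
      using K unfolding proj_open_def by blast
    ultimately show ?thesis
      unfolding proj_open_def by (simp only: simp_thms)
  qed
  ultimately show ?thesis
    unfolding istopology_def by blast
qed

lemma openin_proj_topology: "openin proj_topology S \<longleftrightarrow> proj_open S"
  unfolding proj_topology_def topology_inverse'[OF istopology_proj_open] ..

text \<open>\<open>\<real> \<union> {\<infinity>}\<close> is \<open>real option\<close> with \<open>None\<close> as \<open>\<infinity>\<close>.\<close>

definition real_inf_topology :: "real option topology" where
  "real_inf_topology = Alexandroff_compactification euclideanreal"

text \<open>The product of \<open>\<real> \<union> {\<infinity>}\<close>. The junk value for \<open>0\<close> times \<open>\<infinity>\<close> never matters: below, either both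
  factors are finite or both are nonzero.\<close>

fun rinf_mult :: "real option \<Rightarrow> real option \<Rightarrow> real option" where
  "rinf_mult (Some x) (Some y) = Some (x * y)"
| "rinf_mult _ _ = None"

definition cr_dom :: "('a::real_vector set \<times> 'a set \<times> 'a set \<times> 'a set) set" where
  "cr_dom = {(a, b, c, d). {a, b, c, d} \<subseteq> proj_line \<and>
     \<not> (a = b \<and> b = c) \<and> \<not> (a = b \<and> b = d) \<and> \<not> (a = c \<and> c = d) \<and> \<not> (b = c \<and> c = d)}"

definition quad_topology :: "('a::real_vector set \<times> 'a set \<times> 'a set \<times> 'a set) topology" where
  "quad_topology = prod_topology proj_topology
     (prod_topology proj_topology (prod_topology proj_topology proj_topology))"

text \<open>The normalisation determines the cross-ratio on a dense subset of \<open>cr_dom\<close>, hence, by continuity,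
  on \<open>cr_dom\<close>.\<close>

definition cross_ratio :: "'a::real_vector set \<times> 'a set \<times> 'a set \<times> 'a set \<Rightarrow> real option" where
  "cross_ratio = (THE f. f \<in> extensional cr_dom \<and>
     continuous_map (subtopology quad_topology cr_dom) real_inf_topology f \<and>
     (\<forall>e1 e2 x. lin_indep2 e1 e2 \<longrightarrow>
        f (proj_pt (e1 + x *\<^sub>R e2), proj_pt (e1 + e2), proj_pt e1, proj_pt e2) = Some x))"

text \<open>\<open>cr_case (Some 0)\<close> and \<open>cr_case None\<close> are the cases \<open>C\<^sub>0\<close> and \<open>C\<^sub>\<infinity>\<close>.\<close>

definition cr_case :: "real option \<Rightarrow> ('a::real_vector set \<times> 'a set \<times> 'a set \<times> 'a set) set" where
  "cr_case i = {Q \<in> cr_dom. cross_ratio Q \<noteq> i}"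

text \<open>For \<open>p \<noteq> q\<close> on the projective line there are two closed arcs of extremities \<open>p\<close> and \<open>q\<close>: the closures
  of the two components of the complement of \<open>{p, q}\<close>.\<close>

definition closed_arcs :: "'a::real_vector set \<Rightarrow> 'a set \<Rightarrow> 'a set set set" where
  "closed_arcs p q = (\<lambda>C. proj_topology closure_of C) `
     connected_components_of (subtopology proj_topology (proj_line - {p, q}))"

definition arc_of ::
    "('a::real_vector set \<Rightarrow> 'a set \<Rightarrow> 'a set) \<Rightarrow> 'a set \<Rightarrow> 'a set \<Rightarrow> 'a set set" where
  "arc_of B p q = (THE A. A \<in> closed_arcs p q \<and> B p q \<in> proj_topology interior_of A)"

text \<open>The triple \<open>(a, b, c)\<close> is met in this order when the circle is traversed once in the direction
  from \<open>e1\<close> to \<open>e2\<close>; the parametrisation by the angle has period \<open>pi\<close>.\<close>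

definition pos_cyclic ::
    "'a::real_vector \<Rightarrow> 'a \<Rightarrow> 'a set \<Rightarrow> 'a set \<Rightarrow> 'a set \<Rightarrow> bool" where
  "pos_cyclic e1 e2 a b c \<longleftrightarrow> (\<exists>\<alpha> \<beta> \<gamma> :: real. \<alpha> < \<beta> \<and> \<beta> < \<gamma> \<and> \<gamma> < \<alpha> + pi \<and>
     a = proj_pt (cos \<alpha> *\<^sub>R e1 + sin \<alpha> *\<^sub>R e2) \<and>
     b = proj_pt (cos \<beta> *\<^sub>R e1 + sin \<beta> *\<^sub>R e2) \<and>
     c = proj_pt (cos \<gamma> *\<^sub>R e1 + sin \<gamma> *\<^sub>R e2))"

text \<open>Preservation of the cyclic order of triples. Letting the basis vary covers both orientations of
  the circle, so none has to be chosen.\<close>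

definition orientation_preserving_on ::
    "'a::real_vector set set \<Rightarrow> ('a set \<Rightarrow> 'a set) \<Rightarrow> bool" where
  "orientation_preserving_on U f \<longleftrightarrow>
     (\<forall>e1 e2. lin_indep2 e1 e2 \<longrightarrow>
       (\<forall>a\<in>U. \<forall>b\<in>U. \<forall>c\<in>U. pos_cyclic e1 e2 a b c \<longrightarrow> pos_cyclic e1 e2 (f a) (f b) (f c)))"

definition r_quad ::
    "('a::real_vector set \<Rightarrow> 'a set \<Rightarrow> 'a set) \<Rightarrow> 'a set \<Rightarrow> 'a set \<Rightarrow> 'a set \<Rightarrow> 'a set
      \<Rightarrow> 'a set \<times> 'a set \<times> 'a set \<times> 'a set" where
  "r_quad B q a b c = (B a c, B b c, B a b, q)"

definition r_val ::
    "('a::real_vector set \<Rightarrow> 'a set \<Rightarrow> 'a set) \<Rightarrow> 'a set \<Rightarrow> 'a set \<Rightarrow> 'a set \<Rightarrow> 'a set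
      \<Rightarrow> real option" where
  "r_val B q a b c = cross_ratio (r_quad B q a b c)"

text \<open>The difference is real-valued; it is only meaningful when both terms are finite.\<close>

definition d_val ::
    "('a::real_vector set \<Rightarrow> 'a set \<Rightarrow> 'a set) \<Rightarrow> 'a set \<Rightarrow> 'a set \<Rightarrow> 'a set \<Rightarrow> 'a set \<Rightarrow> 'a set
      \<Rightarrow> real" where
  "d_val B q x y u v = the (r_val B q u x v) - the (r_val B q u y v)"

definition d_defined ::
    "('a::real_vector set \<Rightarrow> 'a set \<Rightarrow> 'a set) \<Rightarrow> 'a set \<Rightarrow> 'a set \<Rightarrow> 'a set \<Rightarrow> 'a set \<Rightarrow> 'a set
      \<Rightarrow> bool" where
  "d_defined B q x y u v \<longleftrightarrow> r_quad B q u x v \<in> cr_case None \<and> r_quad B q u y v \<in> cr_case None"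

end

(* The complement of any point missed by U is an affine line, on which U is an open interval I and
   B(s, t) lies strictly between s and t. The guiding picture is a plane curve gamma parametrised by
   its tangent direction, with B(p, q) the direction of the chord from gamma(p) to gamma(q): (H6)
   relates the six directions of a complete quadrilateral, and in the affine coordinate it becomes a
   Menelaus identity between slopes. If B(p, .) were not injective, it would be constant on some
   interval, and (H6) would propagate this constancy until it contradicts B(a, a) = a < B(a, c). The
   Menelaus identity then shows that, for q at infinity, r_q(x, y, z) is a ratio of differences of
   one function along the curve. For general q, d_q(x, y; u, v) differs from this by the factor
   L(B(x, y)) / L(B(u, v)), where L is a linear form vanishing at q, which gives (C8) and (C9). *)

theory Submission
  imports Defs
begin


section \<open>The projective line as a quotient of the line of angles\<close>

text \<open>The curve itself is never constructed. If X and Y were its coordinates, then Y y - Y x =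
  b x y * (X y - X x) for every chord; adding the chords of a triangle x, y, z and eliminating Y
  gives (X y - X z) / (X x - X z) = (b x z - b x y) / (b y z - b x y), whose right side involves
  slopes only. With F = c * X - k * Y, where c - k * t is the linear form vanishing at q, one gets
  r_q(x, y, z) = (F y - F z) / (F x - F z) and d_q(x, y; u, v) = (F x - F y) / (F u - F v), which
  makes (C7) to (C9) plausible at a glance. The obstacle is that (H6) is silent unless both
  cross-ratios avoid 0 and infinity, that is, unless seven inequations between slopes hold. For
  distinct points injectivity settles six of them and continuity the seventh, so injectivity has to
  be won first, from the restricted identity. Moreover (C5) precedes every affine coordinate and
  must be argued on the circle, and the cross-ratio, given only by a characterisation, must first be
  matched with a formula that is valid in each basis.\<close>

lemma lin_indep2_iff:
  "lin_indep2 u v \<longleftrightarrow> (\<forall>x y. x *\<^sub>R u + y *\<^sub>R v = 0 \<longrightarrow> x = 0 \<and> y = 0)"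
proof
  assume L: "lin_indep2 u v"
  then have ne: "u \<noteq> v" and ind: "independent {u, v}"
    by (auto simp: lin_indep2_def)
  show "\<forall>x y. x *\<^sub>R u + y *\<^sub>R v = 0 \<longrightarrow> x = 0 \<and> y = 0"
  proof (intro allI impI)
    fix x y assume 0: "x *\<^sub>R u + y *\<^sub>R v = 0"
    define c where "c = (\<lambda>w. if w = u then x else y)"
    have s: "(\<Sum>w\<in>{u, v}. c w *\<^sub>R w) = 0"
      using ne 0 by (auto simp: c_def)
    have "c u = 0" "c v = 0"
      using independentD[OF ind _ _ s] by auto
    then show "x = 0 \<and> y = 0" using ne by (auto simp: c_def)
  qed
next
  assume R: "\<forall>x y. x *\<^sub>R u + y *\<^sub>R v = 0 \<longrightarrow> x = 0 \<and> y = 0"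
  have ne: "u \<noteq> v"
    using R[rule_format, of 1 "-1"] by auto
  have "v \<noteq> 0"
    using R[rule_format, of 0 1] by auto
  moreover have "u \<notin> span {v}"
  proof
    assume "u \<in> span {v}"
    then obtain k where "u = k *\<^sub>R v" by (auto simp: span_singleton)
    then show False using R[rule_format, of 1 "-k"] by auto
  qed
  ultimately have "independent {u, v}"
    by (simp add: independent_insert)
  then show "lin_indep2 u v" using ne by (simp add: lin_indep2_def)
qed

lemma proj_line_eq: "proj_line = proj_pt ` {v :: 'a::real_vector. v \<noteq> 0}"
proof (intro set_eqI iffI)
  fix L :: "'a set" assume "L \<in> proj_line"
  then have L: "subspace L" "dim L = 1" by (auto simp: proj_line_def)
  obtain B where B: "B \<subseteq> L" "independent B" "L \<subseteq> span B" "card B = dim L"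
    by (rule basis_exists)
  then obtain v where v: "B = {v}" using L by (metis card_1_singletonE)
  then have "v \<noteq> 0" using B(2) dependent_zero by auto
  moreover have "L = span {v}"
    using B v L(1) by (metis span_minimal subset_antisym)
  ultimately show "L \<in> proj_pt ` {v. v \<noteq> 0}" by (auto simp: proj_pt_def)
next
  fix L :: "'a set" assume "L \<in> proj_pt ` {v. v \<noteq> 0}"
  then obtain v where "v \<noteq> 0" "L = span {v}" by (auto simp: proj_pt_def)
  then show "L \<in> proj_line"
    using dim_span_eq_card_independent[of "{v}"] by (simp add: proj_line_def)
qed

lemma proj_pt_in_proj_line: "v \<noteq> 0 \<Longrightarrow> proj_pt v \<in> proj_line"
  by (simp add: proj_line_eq)

lemma proj_pt_scale: "k \<noteq> 0 \<Longrightarrow> proj_pt (k *\<^sub>R v) = proj_pt v"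
  unfolding proj_pt_def by (rule span_image_scale[of "{v}" "\<lambda>_. k", simplified])

lemma vimage_lincomb_open:
  fixes T :: "(real \<times> real) set"
  assumes "open T"
  shows "open {(x::real, y::real). (x * a + y * c, x * b + y * d) \<in> T}"
proof -
  have "open ((\<lambda>z. (fst z * a + snd z * c, fst z * b + snd z * d)) -` T)"
    using assms by (intro open_vimage continuous_intros)
  also have "(\<lambda>z. (fst z * a + snd z * c, fst z * b + snd z * d)) -` T =
    {(x, y). (x * a + y * c, x * b + y * d) \<in> T}" by auto
  finally show ?thesis .
qed

locale plane_basis =
  fixes e1 e2 :: "'a::real_vector"
  assumes indep: "lin_indep2 e1 e2"
    and spanning: "\<And>v. \<exists>x y. v = x *\<^sub>R e1 + y *\<^sub>R e2"
begin

definition vec :: "real \<Rightarrow> real \<Rightarrow> 'a" where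
  "vec x y = x *\<^sub>R e1 + y *\<^sub>R e2"

lemma vec_cases: obtains x y where "v = vec x y"
  using spanning[of v] by (auto simp: vec_def)

lemma vec_eq_0_iff [simp]: "vec x y = 0 \<longleftrightarrow> x = 0 \<and> y = 0"
  using indep by (auto simp: vec_def lin_indep2_iff)

lemma vec_diff: "vec x y - vec x' y' = vec (x - x') (y - y')"
  by (simp add: vec_def algebra_simps)

lemma vec_add: "vec x y + vec x' y' = vec (x + x') (y + y')"
  by (simp add: vec_def algebra_simps)

lemma vec_scale: "k *\<^sub>R vec x y = vec (k * x) (k * y)"
  by (simp add: vec_def algebra_simps)

lemma vec_eq_iff [simp]: "vec x y = vec x' y' \<longleftrightarrow> x = x' \<and> y = y'"
  using vec_diff[of x y x' y'] vec_eq_0_iff[of "x - x'" "y - y'"] by auto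

lemma lin_indep2_vec: "lin_indep2 (vec a b) (vec c d) \<longleftrightarrow> a * d - b * c \<noteq> 0"
proof -
  have "(\<forall>x y. x * a + y * c = 0 \<and> x * b + y * d = 0 \<longrightarrow> x = 0 \<and> y = 0) \<longleftrightarrow> a * d - b * c \<noteq> 0"
    (is "?L \<longleftrightarrow> ?R")
  proof
    assume L: ?L
    show ?R
    proof
      assume 0: "a * d - b * c = 0"
      have "d = 0 \<and> b = 0" using L[rule_format, of d "-b"] 0 by (auto simp: algebra_simps)
      moreover have "c = 0 \<and> a = 0" using L[rule_format, of c "-a"] 0 by (auto simp: algebra_simps)
      ultimately show False using L[rule_format, of 1 1] by simp
    qed
  next
    assume R: ?R
    show ?L
    proof (intro allI impI)
      fix x y assume h: "x * a + y * c = 0 \<and> x * b + y * d = 0"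
      have "x * (a * d - b * c) = (x * a + y * c) * d - (x * b + y * d) * c"
        and "y * (a * d - b * c) = (x * b + y * d) * a - (x * a + y * c) * b"
        by (simp_all add: algebra_simps)
      then have "x * (a * d - b * c) = 0" "y * (a * d - b * c) = 0" using h by simp_all
      then show "x = 0 \<and> y = 0" using R by simp
    qed
  qed
  then show ?thesis by (simp add: lin_indep2_iff vec_scale vec_add)
qed

lemma proj_pt_vec_eq_iff:
  assumes "vec x y \<noteq> 0" "vec x' y' \<noteq> 0"
  shows "proj_pt (vec x y) = proj_pt (vec x' y') \<longleftrightarrow> x * y' = y * x'"
proof
  assume "proj_pt (vec x y) = proj_pt (vec x' y')"
  then have "vec x y \<in> span {vec x' y'}"
    by (metis proj_pt_def span_base singletonI)
  then obtain k where "vec x y = k *\<^sub>R vec x' y'" by (auto simp: span_singleton)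
  then show "x * y' = y * x'" by (simp add: vec_scale)
next
  assume h: "x * y' = y * x'"
  have "\<exists>k. k \<noteq> 0 \<and> vec x y = k *\<^sub>R vec x' y'"
  proof (cases "x' = 0")
    case True
    then have "y' \<noteq> 0" "x = 0" using assms h by auto
    then show ?thesis using True assms by (intro exI[of _ "y / y'"]) (auto simp: vec_scale)
  next
    case False
    then have "x \<noteq> 0" using assms h by auto
    then show ?thesis using False assms h
      by (intro exI[of _ "x / x'"]) (auto simp: vec_scale field_simps)
  qed
  then show "proj_pt (vec x y) = proj_pt (vec x' y')"
    using proj_pt_scale by metis
qed

text \<open>A change of basis acts on coordinates by a linear, hence continuous, map; so openness
  can be tested in the single basis \<open>e1\<close>, \<open>e2\<close>.\<close>

lemma plane_open_iff: "plane_open S \<longleftrightarrow> open {(x, y). vec x y \<in> S}"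
proof
  assume "plane_open S"
  then show "open {(x, y). vec x y \<in> S}"
    using indep by (simp add: plane_open_def vec_def)
next
  assume S: "open {(x, y). vec x y \<in> S}"
  show "plane_open S"
    unfolding plane_open_def
  proof (intro allI impI)
    fix g1 g2 :: 'a
    assume "lin_indep2 g1 g2"
    obtain a b where g1: "g1 = vec a b" by (rule vec_cases)
    obtain c d where g2: "g2 = vec c d" by (rule vec_cases)
    show "open {(x, y). x *\<^sub>R g1 + y *\<^sub>R g2 \<in> S}"
      using vimage_lincomb_open[OF S, of a c b d] by (simp add: g1 g2 vec_scale vec_add)
  qed
qed

section \<open>The parametrisation of the projective line by angles, with period pi\<close>

definition pt :: "real \<Rightarrow> 'a set" where
  "pt \<theta> = proj_pt (vec (cos \<theta>) (sin \<theta>))"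

lemma vec_cos_sin_nz: "vec (cos \<theta>) (sin \<theta>) \<noteq> 0"
proof
  assume "vec (cos \<theta>) (sin \<theta>) = 0"
  then show False using sin_cos_squared_add[of \<theta>] by simp
qed

lemma pt_in_proj_line [simp]: "pt \<theta> \<in> proj_line"
  by (simp add: pt_def proj_pt_in_proj_line vec_cos_sin_nz del: vec_eq_0_iff)

lemma pt_eq_iff_sin: "pt \<alpha> = pt \<beta> \<longleftrightarrow> sin (\<alpha> - \<beta>) = 0"
  unfolding pt_def proj_pt_vec_eq_iff[OF vec_cos_sin_nz vec_cos_sin_nz]
  by (auto simp: sin_diff algebra_simps)

lemma pt_eq_iff: "pt \<alpha> = pt \<beta> \<longleftrightarrow> (\<exists>k::int. \<alpha> = \<beta> + of_int k * pi)"
  by (auto simp: pt_eq_iff_sin sin_zero_iff_int2 algebra_simps)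

lemma pt_add_pi [simp]: "pt (\<theta> + pi) = pt \<theta>"
  by (simp add: pt_eq_iff_sin)

lemma pt_diff_pi [simp]: "pt (\<theta> - pi) = pt \<theta>"
  using pt_add_pi[of "\<theta> - pi"] by simp

lemma pt_inj: "pt \<alpha> = pt \<beta> \<Longrightarrow> \<bar>\<alpha> - \<beta>\<bar> < pi \<Longrightarrow> \<alpha> = \<beta>"
  using sin_eq_0_pi[of "\<alpha> - \<beta>"] by (auto simp: pt_eq_iff_sin)

lemma polar:
  assumes "vec x y \<noteq> 0"
  obtains \<rho> \<theta> where "\<rho> > 0" "x = \<rho> * cos \<theta>" "y = \<rho> * sin \<theta>" "proj_pt (vec x y) = pt \<theta>"
proof -
  define r where "r = sqrt (x\<^sup>2 + y\<^sup>2)"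
  have "x \<noteq> 0 \<or> y \<noteq> 0" using assms by auto
  then have r: "r > 0" by (auto simp: r_def sum_power2_gt_zero_iff)
  have "(x / r)\<^sup>2 + (y / r)\<^sup>2 = 1"
    using r by (simp add: r_def power_divide add_divide_distrib[symmetric] sum_power2_eq_zero_iff)
      (use \<open>x \<noteq> 0 \<or> y \<noteq> 0\<close> in auto)
  then obtain t where "x / r = cos t" "y / r = sin t" by (rule sincos_total_2pi) auto
  then have t: "x = r * cos t" "y = r * sin t" using r by (auto simp: field_simps)
  have "proj_pt (vec x y) = pt t"
    unfolding pt_def using proj_pt_scale[of r "vec (cos t) (sin t)"] r t by (simp add: vec_scale)
  with r t show thesis by (rule that)
qed

lemma proj_line_vec: "p \<in> proj_line \<Longrightarrow> \<exists>x y. vec x y \<noteq> 0 \<and> p = proj_pt (vec x y)"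
  unfolding proj_line_eq using vec_cases by (metis (mono_tags, lifting) imageE mem_Collect_eq)

lemma proj_line_eq_range_pt: "proj_line = range pt"
  by (auto dest!: proj_line_vec) (metis polar rangeI vec_eq_0_iff)+

lemma pt_cases:
  assumes "p \<in> proj_line"
  obtains \<theta> where "\<alpha> \<le> \<theta>" "\<theta> < \<alpha> + pi" "p = pt \<theta>"
proof -
  obtain t where t: "p = pt t" using assms by (auto simp: proj_line_eq_range_pt)
  define k where "k = \<lfloor>(t - \<alpha>) / pi\<rfloor>"
  have k: "of_int k \<le> (t - \<alpha>) / pi" "(t - \<alpha>) / pi < of_int k + 1"
    unfolding k_def by linarith+
  have "pt (t - of_int k * pi) = pt t"
    unfolding pt_eq_iff by (intro exI[of _ "-k"]) simp
  then show thesis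
    using k t by (intro that[of "t - of_int k * pi"]) (auto simp: field_simps)
qed

lemma proj_open_iff:
  "proj_open S \<longleftrightarrow> S \<subseteq> proj_line \<and> open {(x, y). vec x y \<noteq> 0 \<and> proj_pt (vec x y) \<in> S}"
  by (simp add: proj_open_def openin_plane_topology plane_open_iff del: vec_eq_0_iff)

lemma open_nonzero: "open {(x, y). vec x y \<noteq> 0}"
proof -
  have "{(x, y). vec x y \<noteq> 0} = - {(0, 0)}" by auto
  moreover have "open (- {(0 :: real, 0 :: real)})" by (intro open_Compl closed_singleton)
  ultimately show ?thesis by metis
qed

lemma topspace_proj [simp]: "topspace proj_topology = (proj_line :: 'a set set)"
proof -
  have "proj_open (proj_line :: 'a set set)"
    unfolding proj_open_iff using open_nonzero
    by (simp add: proj_pt_in_proj_line cong: conj_cong del: vec_eq_0_iff)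
  then have "openin proj_topology (proj_line :: 'a set set)"
    by (simp add: openin_proj_topology)
  moreover have "S \<subseteq> proj_line" if "openin proj_topology S" for S :: "'a set set"
    using that by (simp add: openin_proj_topology proj_open_def)
  ultimately show ?thesis
    by (meson openin_subset openin_topspace subset_antisym)
qed

lemma continuous_map_pt: "continuous_map euclideanreal proj_topology pt"
  unfolding continuous_map_def
proof (intro conjI allI impI)
  show "pt \<in> topspace euclideanreal \<rightarrow> topspace proj_topology" by simp
  fix S :: "'a set set" assume "openin proj_topology S"
  then have "open {(x, y). vec x y \<noteq> 0 \<and> proj_pt (vec x y) \<in> S}" (is "open ?T")
    by (simp add: openin_proj_topology proj_open_iff)
  then have "open ((\<lambda>t. (cos t, sin t)) -` ?T)"
    by (intro open_vimage continuous_intros)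
  also have "(\<lambda>t. (cos t, sin t)) -` ?T = {x \<in> topspace euclideanreal. pt x \<in> S}"
    using vec_cos_sin_nz by (auto simp: pt_def)
  finally show "openin euclideanreal {x \<in> topspace euclideanreal. pt x \<in> S}" by simp
qed

text \<open>Near a vector of angle \<open>\<theta>\<close>, the angle depends continuously on the vector through \<open>arctan\<close>.\<close>

lemma openin_pt_image:
  assumes T: "open T"
  shows "openin proj_topology (pt ` T)"
proof -
  \<comment> \<open>The quotient is formed from the coordinates of \<open>z\<close> in the frame
    rotated by \<open>\<theta>\<close>. Each \<open>\<theta>\<close> in \<open>T\<close> is the
    centre of its own chart, in which the vectors on the line \<open>pt \<theta>\<close> have
    relative angle 0; so no global branch of the angle has to be chosen.\<close>
  define G where "G \<theta> = {z :: real \<times> real. fst z * cos \<theta> + snd z * sin \<theta> \<noteq> 0} \<inter>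
    (\<lambda>z. \<theta> + arctan ((snd z * cos \<theta> - fst z * sin \<theta>) / (fst z * cos \<theta> + snd z * sin \<theta>))) -` T"
    for \<theta>
  have "open (G \<theta>)" for \<theta>
    unfolding G_def
    by (intro continuous_open_preimage T continuous_intros open_Collect_neq) auto
  then have "open (\<Union>\<theta>\<in>T. G \<theta>)" by blast
  also have "(\<Union>\<theta>\<in>T. G \<theta>) = {(x, y). vec x y \<noteq> 0 \<and> proj_pt (vec x y) \<in> pt ` T}"
  proof (intro set_eqI iffI)
    fix z assume "z \<in> (\<Union>\<theta>\<in>T. G \<theta>)"
    moreover obtain x y where z: "z = (x, y)" by (rule prod.exhaust)
    ultimately obtain \<theta> where \<theta>: "x * cos \<theta> + y * sin \<theta> \<noteq> 0"
      "\<theta> + arctan ((y * cos \<theta> - x * sin \<theta>) / (x * cos \<theta> + y * sin \<theta>)) \<in> T"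
      by (auto simp: G_def)
    define \<beta> where "\<beta> = arctan ((y * cos \<theta> - x * sin \<theta>) / (x * cos \<theta> + y * sin \<theta>))"
    have nz: "vec x y \<noteq> 0" using \<theta>(1) by auto
    have cb: "cos \<beta> \<noteq> 0" by (simp add: \<beta>_def)
    have "tan \<beta> = (y * cos \<theta> - x * sin \<theta>) / (x * cos \<theta> + y * sin \<theta>)"
      by (simp add: \<beta>_def tan_arctan)
    then have "sin \<beta> * (x * cos \<theta> + y * sin \<theta>) = cos \<beta> * (y * cos \<theta> - x * sin \<theta>)"
      using \<theta>(1) cb by (simp add: tan_def field_simps)
    then have "x * sin (\<theta> + \<beta>) = y * cos (\<theta> + \<beta>)"
      by (simp add: sin_add cos_add algebra_simps)
    then have "proj_pt (vec x y) = pt (\<theta> + \<beta>)"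
      unfolding pt_def proj_pt_vec_eq_iff[OF nz vec_cos_sin_nz] .
    then show "z \<in> {(x, y). vec x y \<noteq> 0 \<and> proj_pt (vec x y) \<in> pt ` T}"
      using z nz \<theta>(2) by (auto simp: \<beta>_def)
  next
    fix z assume "z \<in> {(x, y). vec x y \<noteq> 0 \<and> proj_pt (vec x y) \<in> pt ` T}"
    then obtain x y \<theta> where z: "z = (x, y)" and nz: "vec x y \<noteq> 0" and
      \<theta>: "\<theta> \<in> T" "proj_pt (vec x y) = pt \<theta>" by auto
    have eq: "x * sin \<theta> = y * cos \<theta>"
      using \<theta>(2) unfolding pt_def proj_pt_vec_eq_iff[OF nz vec_cos_sin_nz] .
    have "x * cos \<theta> + y * sin \<theta> \<noteq> 0"
    proof
      assume 0: "x * cos \<theta> + y * sin \<theta> = 0"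
      have "x * ((sin \<theta>)\<^sup>2 + (cos \<theta>)\<^sup>2) = sin \<theta> * (x * sin \<theta>) + cos \<theta> * (x * cos \<theta>)"
        unfolding power2_eq_square by algebra
      also have "\<dots> = cos \<theta> * (x * cos \<theta> + y * sin \<theta>)" unfolding eq by (simp add: algebra_simps)
      finally have x: "x = 0" using 0 by simp
      then have "y * ((sin \<theta>)\<^sup>2 + (cos \<theta>)\<^sup>2) = 0"
        using 0 eq by (auto simp: power2_eq_square)
      then show False using x nz by simp
    qed
    then have "z \<in> G \<theta>" using eq \<theta>(1) by (simp add: G_def z)
    then show "z \<in> (\<Union>\<theta>\<in>T. G \<theta>)" using \<theta>(1) by blast
  qed
  finally show ?thesis
    by (auto simp: openin_proj_topology proj_open_iff)
qed

text \<open>Continuity of maps out of the projective line can therefore be tested on angles.\<close>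

lemma quotient_map_pt: "quotient_map euclideanreal proj_topology pt"
  by (rule continuous_open_imp_quotient_map)
    (auto simp: continuous_map_pt open_map_def openin_pt_image proj_line_eq_range_pt)

text \<open>Doubling the angle turns the period \<open>pi\<close> of \<open>pt\<close> into the
  period \<open>2 * pi\<close> of \<open>cis\<close>, so the chosen angle does not matter and the
  projective line is embedded in the unit circle. This yields the Hausdorff property and coordinates
  for the cross-ratio without an exceptional point.\<close>

definition circ :: "'a set \<Rightarrow> complex" where
  "circ p = cis (2 * (SOME \<theta>. p = pt \<theta>))"

lemma cis_double_diff: "cis (2 * \<alpha>) - cis (2 * \<beta>) = 2 * \<i> * of_real (sin (\<alpha> - \<beta>)) * cis (\<alpha> + \<beta>)"
proof -
  have "cis (x + y) - cis (x - y) = 2 * \<i> * of_real (sin y) * cis x" for x y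
    by (simp add: complex_eq_iff cos_add sin_add cos_diff sin_diff)
  from this[of "\<alpha> + \<beta>" "\<alpha> - \<beta>"] show ?thesis by simp
qed

lemma circ_pt: "circ (pt \<theta>) = cis (2 * \<theta>)"
proof -
  have "pt \<theta> = pt (SOME t. pt \<theta> = pt t)" by (rule someI[of _ \<theta>]) simp
  then have "sin (\<theta> - (SOME t. pt \<theta> = pt t)) = 0" by (simp add: pt_eq_iff_sin)
  then have "cis (2 * \<theta>) - circ (pt \<theta>) = 0"
    unfolding circ_def cis_double_diff by simp
  then show ?thesis by simp
qed

lemma continuous_map_circ: "continuous_map proj_topology euclidean circ"
proof -
  have "continuous_map euclideanreal euclidean (circ \<circ> pt)"
    by (auto simp: circ_pt o_def cis_conv_exp intro!: continuous_intros)
  then show ?thesis by (rule continuous_compose_quotient_map[OF quotient_map_pt])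
qed

lemma circ_diff: "circ (pt \<alpha>) - circ (pt \<beta>) = 2 * \<i> * of_real (sin (\<alpha> - \<beta>)) * cis (\<alpha> + \<beta>)"
  by (simp add: circ_pt cis_double_diff)

lemma circ_inj: "p \<in> proj_line \<Longrightarrow> q \<in> proj_line \<Longrightarrow> circ p = circ q \<longleftrightarrow> p = q"
proof -
  assume "p \<in> proj_line" "q \<in> proj_line"
  then obtain \<alpha> \<beta> where "p = pt \<alpha>" "q = pt \<beta>" by (auto simp: proj_line_eq_range_pt)
  then show ?thesis using circ_diff[of \<alpha> \<beta>] by (auto simp: pt_eq_iff_sin)
qed

lemma Hausdorff_proj: "Hausdorff_space (proj_topology :: 'a set topology)"
  by (rule Hausdorff_space_injective_preimage[OF Hausdorff_space_euclidean continuous_map_circ])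
    (auto simp: inj_on_def circ_inj)

end

section \<open>The cross-ratio in coordinates\<close>

text \<open>Keeping numerator and denominator apart until here makes infinity an ordinary value. The
  real part is a coercion to \<open>real\<close>: the quotients to which the continuity statement
  applies are real.\<close>

definition complex_ratio :: "complex \<times> complex \<Rightarrow> real option" where
  "complex_ratio z = (if snd z = 0 then None else Some (Re (fst z / snd z)))"

lemma continuous_map_complex_ratio:
  "continuous_map (top_of_set {z. z \<noteq> 0 \<and> (snd z = 0 \<or> fst z / snd z \<in> \<real>)}) real_inf_topology
     complex_ratio"
    (is "continuous_map (top_of_set ?G) _ _")
  unfolding continuous_map_def
proof (intro conjI allI impI)
  show "complex_ratio \<in> topspace (top_of_set ?G) \<rightarrow> topspace real_inf_topology"
    by (auto simp: real_inf_topology_def complex_ratio_def)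
  have op: "open {z :: complex \<times> complex. snd z \<noteq> 0 \<and> Re (fst z / snd z) \<in> V}" if "open V" for V
  proof -
    have "open ({z :: complex \<times> complex. snd z \<noteq> 0} \<inter> (\<lambda>z. Re (fst z / snd z)) -` V)"
      by (intro continuous_open_preimage that continuous_intros open_Collect_neq) auto
    also have "{z :: complex \<times> complex. snd z \<noteq> 0} \<inter> (\<lambda>z. Re (fst z / snd z)) -` V =
      {z. snd z \<noteq> 0 \<and> Re (fst z / snd z) \<in> V}" by auto
    finally show ?thesis .
  qed
  fix S assume "openin real_inf_topology S"
  then consider V where "open V" "S = Some ` V"
    | C where "compact C" "S = insert None (Some ` (UNIV - C))"
    by (auto simp: real_inf_topology_def openin_Alexandroff_compactification)
  then show "openin (top_of_set ?G) {z \<in> topspace (top_of_set ?G). complex_ratio z \<in> S}"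
  proof cases
    case 1
    then have "{z \<in> topspace (top_of_set ?G). complex_ratio z \<in> S} =
        ?G \<inter> {z. snd z \<noteq> 0 \<and> Re (fst z / snd z) \<in> V}"
      by (auto simp: complex_ratio_def)
    then show ?thesis using op[OF 1(1)] by (simp add: openin_open_Int)
  next
    case 2
    obtain K where K: "\<And>x. x \<in> C \<Longrightarrow> \<bar>x\<bar> \<le> K"
      using compact_imp_bounded[OF 2(1)] by (auto simp: bounded_iff)
    \<comment> \<open>\<open>C\<close> lies in the interval from \<open>-K\<close> to
      \<open>K\<close>. The second set collects the large ratios by a strict inequality without
      division, so it is open and also contains the nonzero pairs with denominator 0.\<close>
    define H where "H = {z :: complex \<times> complex. snd z \<noteq> 0 \<and> Re (fst z / snd z) \<in> - C} \<union>
      {z. K * norm (snd z) < norm (fst z)}"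
    have "open H"
      unfolding H_def
      by (intro open_Un op open_Collect_less continuous_intros)
        (use 2(1) compact_imp_closed in auto)
    moreover have "{z \<in> topspace (top_of_set ?G). complex_ratio z \<in> S} = ?G \<inter> H"
    proof -
      have "complex_ratio z \<in> S \<longleftrightarrow> z \<in> H" if z: "z \<in> ?G" for z
      proof (cases "snd z = 0")
        case True
        then show ?thesis using z 2(2) by (auto simp: complex_ratio_def H_def prod_eq_iff)
      next
        case False
        have "Re (fst z / snd z) \<notin> C" if "K * norm (snd z) < norm (fst z)"
        proof
          assume "Re (fst z / snd z) \<in> C"
          moreover have "\<bar>Re (fst z / snd z)\<bar> = norm (fst z / snd z)"
            using z False by (auto simp: in_Reals_norm)
          ultimately have "norm (fst z / snd z) \<le> K" using K by metis
          then show False using that False by (simp add: norm_divide field_simps)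
        qed
        then show ?thesis using False 2(2) by (auto simp: complex_ratio_def H_def)
      qed
      then show ?thesis by auto
    qed
    ultimately show ?thesis by (simp add: openin_open_Int)
  qed
qed

lemma Hausdorff_real_inf: "Hausdorff_space real_inf_topology"
  unfolding real_inf_topology_def
  by (subst Hausdorff_space_Alexandroff_compactification)
    (auto simp: locally_compact_space_euclidean)

text \<open>The zeros of the sine are isolated, because the cosine does not vanish there. This
  serves to separate coinciding points by small rotations.\<close>

lemma eventually_sin_shift_nonzero:
  fixes d k :: real
  assumes "k \<noteq> 0"
  shows "eventually (\<lambda>\<epsilon>. sin (d + k * \<epsilon>) \<noteq> 0) (at 0)"
proof (cases "sin d = 0")
  case False
  have "((\<lambda>\<epsilon>. sin (d + k * \<epsilon>)) \<longlongrightarrow> sin d) (at 0)"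
    by (auto intro!: tendsto_eq_intros)
  then show ?thesis using False by (intro tendsto_imp_eventually_ne) auto
next
  case True
  then have c: "cos d \<noteq> 0" using sin_cos_squared_add[of d] by auto
  have "((\<lambda>\<epsilon>. sin (d + k * \<epsilon>)) has_field_derivative k * cos d) (at 0)"
    by (auto intro!: derivative_eq_intros)
  then have "((\<lambda>\<epsilon>. sin (d + k * \<epsilon>) / \<epsilon>) \<longlongrightarrow> k * cos d) (at 0)"
    using True by (simp add: has_field_derivative_iff)
  then have "eventually (\<lambda>\<epsilon>. sin (d + k * \<epsilon>) / \<epsilon> \<noteq> 0) (at 0)"
    by (rule tendsto_imp_eventually_ne) (use c assms in simp)
  then show ?thesis by eventually_elim simp
qed

context plane_basis
begin

text \<open>\<open>cis (2 * \<theta>)\<close> is a Moebius function of \<open>tan \<theta>\<close>, so \<open>circ\<close> preserves cross-ratios.\<close>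

definition cr_pair :: "'a set \<times> 'a set \<times> 'a set \<times> 'a set \<Rightarrow> complex \<times> complex" where
  "cr_pair = (\<lambda>(a, b, c, d).
     ((circ a - circ c) * (circ b - circ d), (circ a - circ d) * (circ b - circ c)))"

definition cr :: "'a set \<times> 'a set \<times> 'a set \<times> 'a set \<Rightarrow> real option" where
  "cr = restrict (complex_ratio \<circ> cr_pair) cr_dom"

text \<open>Both components involve every angle once, so they share the same nonzero complex factor;
  what remains of their quotient is a real cross-ratio of sines.\<close>

lemma cr_pair_pt:
  "cr_pair (pt \<alpha>, pt \<beta>, pt \<gamma>, pt \<delta>) =
     ((2 * \<i>)\<^sup>2 * cis (\<alpha> + \<beta> + \<gamma> + \<delta>) * of_real (sin (\<alpha> - \<gamma>) * sin (\<beta> - \<delta>)),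
      (2 * \<i>)\<^sup>2 * cis (\<alpha> + \<beta> + \<gamma> + \<delta>) * of_real (sin (\<alpha> - \<delta>) * sin (\<beta> - \<gamma>)))"
proof -
  have "cis (\<alpha> + \<gamma>) * cis (\<beta> + \<delta>) = cis (\<alpha> + \<beta> + \<gamma> + \<delta>)"
    "cis (\<alpha> + \<delta>) * cis (\<beta> + \<gamma>) = cis (\<alpha> + \<beta> + \<gamma> + \<delta>)"
    by (simp_all add: cis_mult algebra_simps)
  moreover have "(2 * \<i> * of_real s * x) * (2 * \<i> * of_real t * y) = (2 * \<i>)\<^sup>2 * (x * y) * of_real (s * t)"
    for s t :: real and x y by (simp add: power2_eq_square)
  ultimately show ?thesis
    unfolding cr_pair_def by (simp only: prod.case circ_diff)
qed

lemma complex_ratio_cr_pair_pt: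
  "complex_ratio (cr_pair (pt \<alpha>, pt \<beta>, pt \<gamma>, pt \<delta>)) =
     (if sin (\<alpha> - \<delta>) * sin (\<beta> - \<gamma>) = 0 then None
      else Some (sin (\<alpha> - \<gamma>) * sin (\<beta> - \<delta>) / (sin (\<alpha> - \<delta>) * sin (\<beta> - \<gamma>))))"
proof -
  have "((2 * \<i>)\<^sup>2 * cis t * of_real n) / ((2 * \<i>)\<^sup>2 * cis t * of_real d) = of_real (n / d)" for t n d :: real
    by simp
  then show ?thesis
    unfolding complex_ratio_def cr_pair_pt fst_conv snd_conv by (simp del: of_real_mult)
qed

text \<open>Both products vanish only if a factor of each does, and any such choice makes three of
  the four points coincide, which is exactly what \<open>cr_dom\<close> excludes.\<close>

lemma cr_pair_in:
  assumes "Q \<in> cr_dom"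
  shows "cr_pair Q \<in> {z. z \<noteq> 0 \<and> (snd z = 0 \<or> fst z / snd z \<in> \<real>)}"
proof -
  obtain \<alpha> \<beta> \<gamma> \<delta> where Q: "Q = (pt \<alpha>, pt \<beta>, pt \<gamma>, pt \<delta>)"
    using assms by (auto simp: cr_dom_def proj_line_eq_range_pt)
  have "((2 * \<i>)\<^sup>2 * cis t * of_real n) / ((2 * \<i>)\<^sup>2 * cis t * of_real d) = of_real (n / d)" for t n d :: real
    by simp
  then have 1: "fst (cr_pair Q) / snd (cr_pair Q) \<in> \<real>"
    unfolding Q cr_pair_pt fst_conv snd_conv by (metis Reals_of_real)
  have "cr_pair Q \<noteq> 0"
  proof
    assume "cr_pair Q = 0"
    then have "(pt \<alpha> = pt \<gamma> \<or> pt \<beta> = pt \<delta>) \<and> (pt \<alpha> = pt \<delta> \<or> pt \<beta> = pt \<gamma>)"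
      unfolding Q cr_pair_def by (simp add: prod_eq_iff circ_inj)
    then show False using assms unfolding Q cr_dom_def by auto
  qed
  with 1 show ?thesis by simp
qed

lemma continuous_map_cr_pair:
  "continuous_map quad_topology euclidean cr_pair"
proof -
  have "continuous_map quad_topology (prod_topology euclidean (prod_topology euclidean (prod_topology euclidean euclidean)))
      (\<lambda>Q. (circ (fst Q), circ (fst (snd Q)), circ (fst (snd (snd Q))), circ (snd (snd (snd Q)))))"
    unfolding quad_topology_def
    by (intro continuous_map_pairedI continuous_map_compose[unfolded o_def, OF _ continuous_map_circ] continuous_map_fst
        continuous_map_compose[unfolded o_def, OF continuous_map_snd continuous_map_fst]
        continuous_map_compose[unfolded o_def, OF continuous_map_compose[unfolded o_def, OF continuous_map_snd continuous_map_snd] continuous_map_fst]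
        continuous_map_compose[unfolded o_def, OF continuous_map_compose[unfolded o_def, OF continuous_map_snd continuous_map_snd] continuous_map_snd])
  then have "continuous_map quad_topology euclidean
      (\<lambda>Q. (circ (fst Q), circ (fst (snd Q)), circ (fst (snd (snd Q))), circ (snd (snd (snd Q)))))"
    by (simp add: euclidean_product_topology)
  moreover have "continuous_map euclidean euclidean (\<lambda>z :: complex \<times> complex \<times> complex \<times> complex.
      ((fst z - fst (snd (snd z))) * (fst (snd z) - snd (snd (snd z))),
       (fst z - snd (snd (snd z))) * (fst (snd z) - fst (snd (snd z)))))"
    by (auto intro!: continuous_intros)
  ultimately have "continuous_map quad_topology euclidean
    ((\<lambda>z :: complex \<times> complex \<times> complex \<times> complex.
      ((fst z - fst (snd (snd z))) * (fst (snd z) - snd (snd (snd z))),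
       (fst z - snd (snd (snd z))) * (fst (snd z) - fst (snd (snd z))))) \<circ>
     (\<lambda>Q. (circ (fst Q), circ (fst (snd Q)), circ (fst (snd (snd Q))), circ (snd (snd (snd Q))))))"
    by (rule continuous_map_compose)
  moreover have "cr_pair = (\<lambda>Q. ((circ (fst Q) - circ (fst (snd (snd Q)))) *
        (circ (fst (snd Q)) - circ (snd (snd (snd Q)))),
      (circ (fst Q) - circ (snd (snd (snd Q)))) * (circ (fst (snd Q)) - circ (fst (snd (snd Q))))))"
    by (auto simp: cr_pair_def fun_eq_iff)
  ultimately show ?thesis by (simp add: o_def)
qed

lemma topspace_quad: "topspace quad_topology = proj_line \<times> proj_line \<times> proj_line \<times> (proj_line :: 'a set set)"
  by (simp add: quad_topology_def)

lemma cr_dom_subset: "cr_dom \<subseteq> topspace (quad_topology :: ('a set \<times> 'a set \<times> 'a set \<times> 'a set) topology)"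
  by (auto simp: cr_dom_def topspace_quad)

lemma continuous_map_cr: "continuous_map (subtopology quad_topology cr_dom) real_inf_topology cr"
proof -
  have "continuous_map (subtopology quad_topology cr_dom)
      (top_of_set {z. z \<noteq> 0 \<and> (snd z = 0 \<or> fst z / snd z \<in> \<real>)}) cr_pair"
    using cr_pair_in
    by (auto simp: continuous_map_in_subtopology continuous_map_from_subtopology continuous_map_cr_pair)
  from continuous_map_compose[OF this continuous_map_complex_ratio]
  have "continuous_map (subtopology quad_topology cr_dom) real_inf_topology (complex_ratio \<circ> cr_pair)" .
  then show ?thesis
    by (rule continuous_map_eq) (auto simp: cr_def)
qed

text \<open>Up to sign, a determinant is the product of two lengths and the sine of an angle
  difference; each length occurs once in the numerator and once in the denominator.\<close>

lemma cr_vec: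
  assumes Q: "(proj_pt (vec a1 a2), proj_pt (vec b1 b2), proj_pt (vec c1 c2), proj_pt (vec d1 d2)) \<in> cr_dom"
    and nz: "vec a1 a2 \<noteq> 0" "vec b1 b2 \<noteq> 0" "vec c1 c2 \<noteq> 0" "vec d1 d2 \<noteq> 0"
  shows "cr (proj_pt (vec a1 a2), proj_pt (vec b1 b2), proj_pt (vec c1 c2), proj_pt (vec d1 d2)) =
    (if (a1 * d2 - a2 * d1) * (b1 * c2 - b2 * c1) = 0 then None
     else Some ((a1 * c2 - a2 * c1) * (b1 * d2 - b2 * d1) / ((a1 * d2 - a2 * d1) * (b1 * c2 - b2 * c1))))"
proof -
  obtain r \<alpha> where a: "r > 0" "a1 = r * cos \<alpha>" "a2 = r * sin \<alpha>" "proj_pt (vec a1 a2) = pt \<alpha>"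
    using polar[OF nz(1)] .
  obtain s \<beta> where b: "s > 0" "b1 = s * cos \<beta>" "b2 = s * sin \<beta>" "proj_pt (vec b1 b2) = pt \<beta>"
    using polar[OF nz(2)] .
  obtain t \<gamma> where c: "t > 0" "c1 = t * cos \<gamma>" "c2 = t * sin \<gamma>" "proj_pt (vec c1 c2) = pt \<gamma>"
    using polar[OF nz(3)] .
  obtain u \<delta> where d: "u > 0" "d1 = u * cos \<delta>" "d2 = u * sin \<delta>" "proj_pt (vec d1 d2) = pt \<delta>"
    using polar[OF nz(4)] .
  have W: "(x * cos \<phi>) * (y * sin \<psi>) - (x * sin \<phi>) * (y * cos \<psi>) = - (x * y) * sin (\<phi> - \<psi>)" for x y \<phi> \<psi> :: real
    by (simp add: sin_diff algebra_simps)
  have "cr (pt \<alpha>, pt \<beta>, pt \<gamma>, pt \<delta>) =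
     (if sin (\<alpha> - \<delta>) * sin (\<beta> - \<gamma>) = 0 then None
      else Some (sin (\<alpha> - \<gamma>) * sin (\<beta> - \<delta>) / (sin (\<alpha> - \<delta>) * sin (\<beta> - \<gamma>))))"
    using Q unfolding a(4) b(4) c(4) d(4) cr_def by (simp add: complex_ratio_cr_pair_pt)
  then show ?thesis
    unfolding a(4) b(4) c(4) d(4) unfolding a b c d W using a(1) b(1) c(1) d(1)
    by (simp add: field_simps)
qed

lemma cr_normalised:
  assumes "lin_indep2 u v"
  shows "cr (proj_pt (u + x *\<^sub>R v), proj_pt (u + v), proj_pt u, proj_pt v) = Some x"
proof -
  obtain a b where u: "u = vec a b" by (rule vec_cases)
  obtain c d where v: "v = vec c d" by (rule vec_cases)
  have D: "a * d - b * c \<noteq> 0" using assms by (simp add: u v lin_indep2_vec)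
  have 1: "u + x *\<^sub>R v = vec (a + x * c) (b + x * d)" "u + v = vec (a + c) (b + d)"
    by (simp_all add: u v vec_scale vec_add)
  have ad: "(a + x * c) * d - (b + x * d) * c = a * d - b * c"
    and bc: "(a + c) * b - (b + d) * a = - (a * d - b * c)"
    and ac: "(a + x * c) * b - (b + x * d) * a = - x * (a * d - b * c)"
    and bd: "(a + c) * d - (b + d) * c = a * d - b * c"
    by (simp_all add: algebra_simps)
  have nz: "vec (a + x * c) (b + x * d) \<noteq> 0" "vec (a + c) (b + d) \<noteq> 0" "vec a b \<noteq> 0" "vec c d \<noteq> 0"
    using ad bd D by auto
  have "proj_pt (vec (a + x * c) (b + x * d)) \<noteq> proj_pt (vec c d)"
    "proj_pt (vec (a + c) (b + d)) \<noteq> proj_pt (vec a b)"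
    "proj_pt (vec (a + c) (b + d)) \<noteq> proj_pt (vec c d)"
    "proj_pt (vec a b) \<noteq> proj_pt (vec c d)"
    using ad bc bd D by (auto simp: proj_pt_vec_eq_iff[OF nz(1,4)] proj_pt_vec_eq_iff[OF nz(2,3)]
        proj_pt_vec_eq_iff[OF nz(2,4)] proj_pt_vec_eq_iff[OF nz(3,4)])
  then have "(proj_pt (vec (a + x * c) (b + x * d)), proj_pt (vec (a + c) (b + d)),
      proj_pt (vec a b), proj_pt (vec c d)) \<in> cr_dom"
    using nz by (auto simp: cr_dom_def proj_pt_in_proj_line simp del: vec_eq_0_iff)
  note cr_vec[OF this nz]
  moreover have "- x * \<delta> * \<delta> / (\<delta> * - \<delta>) = x" if "\<delta> \<noteq> 0" for \<delta> by (use that in simp)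
  ultimately show ?thesis
    unfolding 1 unfolding u v ad bc ac bd using D
    by (simp only: mult_eq_0_iff neg_equal_0_iff_equal simp_thms if_False)
qed

lemma normalised_quadruple:
  fixes a b c d :: "'a set"
  assumes "b \<noteq> c" "b \<noteq> d" "c \<noteq> d" "a \<noteq> d" "{a, b, c, d} \<subseteq> proj_line"
  obtains u v x where "lin_indep2 u v"
    "(a, b, c, d) = (proj_pt (u + x *\<^sub>R v), proj_pt (u + v), proj_pt u, proj_pt v)"
proof -
  obtain a1 a2 b1 b2 c1 c2 d1 d2 where
    nz: "vec a1 a2 \<noteq> 0" "vec b1 b2 \<noteq> 0" "vec c1 c2 \<noteq> 0" "vec d1 d2 \<noteq> 0" and
    e: "a = proj_pt (vec a1 a2)" "b = proj_pt (vec b1 b2)" "c = proj_pt (vec c1 c2)" "d = proj_pt (vec d1 d2)"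
    using assms(5) proj_line_vec by (metis insert_subset)
  define bd bc ad ac cd where "bd = b1 * d2 - b2 * d1" and "bc = b1 * c2 - b2 * c1"
    and "ad = a1 * d2 - a2 * d1" and "ac = a1 * c2 - a2 * c1" and "cd = c1 * d2 - c2 * d1"
  have n: "bd \<noteq> 0" "bc \<noteq> 0" "ad \<noteq> 0" "cd \<noteq> 0"
    using assms(1-4) unfolding e bd_def bc_def ad_def cd_def
    by (auto simp: proj_pt_vec_eq_iff[OF nz(1,4)] proj_pt_vec_eq_iff[OF nz(2,3)]
        proj_pt_vec_eq_iff[OF nz(2,4)] proj_pt_vec_eq_iff[OF nz(3,4)] simp del: vec_eq_0_iff)
  \<comment> \<open>By Cramer's rule, \<open>cd\<close> times the vector of \<open>b\<close> is
    \<open>bd\<close> times that of \<open>c\<close> minus \<open>bc\<close> times that of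
    \<open>d\<close>; these two terms are \<open>u\<close> and \<open>v\<close>. The scalar
    \<open>x\<close> below is the value predicted by \<open>cr_vec\<close>.\<close>
  define u v where "u = bd *\<^sub>R vec c1 c2" and "v = (- bc) *\<^sub>R vec d1 d2"
  define x where "x = ac * bd / (ad * bc)"
  have "c = proj_pt u" "d = proj_pt v"
    using n proj_pt_scale[of bd "vec c1 c2"] proj_pt_scale[of "- bc" "vec d1 d2"]
    by (simp_all add: u_def v_def e)
  moreover have "u + v = cd *\<^sub>R vec b1 b2"
    unfolding u_def v_def vec_scale vec_add vec_eq_iff bd_def bc_def cd_def
    by (simp add: algebra_simps)
  then have "b = proj_pt (u + v)" using n by (simp add: e proj_pt_scale)
  moreover have "u + x *\<^sub>R v = (bd * cd / ad) *\<^sub>R vec a1 a2"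
  proof -
    have "ad *\<^sub>R (u + x *\<^sub>R v) = (bd * cd) *\<^sub>R vec a1 a2"
    proof -
      have "ad *\<^sub>R (u + x *\<^sub>R v) = (bd * ad) *\<^sub>R vec c1 c2 + (- ac * bd) *\<^sub>R vec d1 d2"
        using n by (simp add: u_def v_def x_def scaleR_add_right scaleR_right_diff_distrib mult.commute)
      also have "\<dots> = (bd * cd) *\<^sub>R vec a1 a2"
        unfolding vec_scale vec_add vec_eq_iff ad_def ac_def cd_def by (simp add: algebra_simps)
      finally show ?thesis .
    qed
    then have "(1 / ad) *\<^sub>R ad *\<^sub>R (u + x *\<^sub>R v) = (1 / ad) *\<^sub>R (bd * cd) *\<^sub>R vec a1 a2" by simp
    then show ?thesis using n by simp
  qed
  then have "a = proj_pt (u + x *\<^sub>R v)" using n by (simp add: e proj_pt_scale)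
  moreover have "lin_indep2 u v"
  proof -
    have "(bd * c1) * (- bc * d2) - (bd * c2) * (- bc * d1) = - (bd * bc * cd)"
      by (simp add: cd_def algebra_simps)
    then show ?thesis using n unfolding u_def v_def vec_scale lin_indep2_vec by simp
  qed
  ultimately show thesis using that by blast
qed

text \<open>The normalised quadruples are dense: turn the four points at four different speeds.\<close>

lemma cr_unique:
  assumes f: "continuous_map (subtopology quad_topology cr_dom) real_inf_topology f"
    and norm: "\<And>u v x. lin_indep2 u v \<Longrightarrow>
        f (proj_pt (u + x *\<^sub>R v), proj_pt (u + v), proj_pt u, proj_pt v) = Some x"
    and Q: "Q \<in> cr_dom"
  shows "f Q = cr Q"
proof -
  define S where "S = {(a, b, c, d). b \<noteq> c \<and> b \<noteq> d \<and> c \<noteq> d \<and> a \<noteq> d \<and> {a, b, c, d} \<subseteq> (proj_line :: 'a set set)}"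
  obtain \<alpha> \<beta> \<gamma> \<delta> where Q_eq: "Q = (pt \<alpha>, pt \<beta>, pt \<gamma>, pt \<delta>)"
    using Q by (auto simp: cr_dom_def proj_line_eq_range_pt)
  define h where "h \<epsilon> = (pt \<alpha>, pt (\<beta> + \<epsilon>), pt (\<gamma> + 2 * \<epsilon>), pt (\<delta> + 3 * \<epsilon>))" for \<epsilon>
  have h0: "h 0 = Q" by (simp add: h_def Q_eq)
  have h: "continuous_map euclideanreal quad_topology h"
    unfolding h_def quad_topology_def
    by (intro continuous_map_pairedI continuous_map_compose[unfolded o_def, OF _ continuous_map_pt])
      (auto intro!: continuous_intros)
  have "eventually (\<lambda>\<epsilon>. sin ((\<beta> - \<gamma>) + (-1) * \<epsilon>) \<noteq> 0 \<and> sin ((\<beta> - \<delta>) + (-2) * \<epsilon>) \<noteq> 0 \<and>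
      sin ((\<gamma> - \<delta>) + (-1) * \<epsilon>) \<noteq> 0 \<and> sin ((\<alpha> - \<delta>) + (-3) * \<epsilon>) \<noteq> 0) (at 0)"
    by (intro eventually_conj eventually_sin_shift_nonzero) auto
  then have ev: "eventually (\<lambda>\<epsilon>. h \<epsilon> \<in> S) (at 0)"
  proof eventually_elim
    case (elim \<epsilon>)
    then show ?case
      unfolding h_def S_def by (simp add: pt_eq_iff_sin algebra_simps)
  qed
  have "S \<subseteq> cr_dom" by (auto simp: S_def cr_dom_def)
  \<comment> \<open>Both \<open>f\<close> and \<open>cr\<close> are continuous into a Hausdorff
    space, and the normalisation fixes both on \<open>S\<close>; so it suffices that
    \<open>Q\<close> is a limit of points of \<open>S\<close>.\<close>
  have "Q \<in> (subtopology quad_topology cr_dom) closure_of S"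
    unfolding in_closure_of
  proof (intro conjI allI impI)
    show "Q \<in> topspace (subtopology quad_topology cr_dom)" using Q cr_dom_subset by auto
    fix T assume T: "Q \<in> T \<and> openin (subtopology quad_topology cr_dom) T"
    then obtain T' where T': "openin quad_topology T'" "T = T' \<inter> cr_dom"
      by (auto simp: openin_subtopology)
    have "open {\<epsilon>. h \<epsilon> \<in> T'}"
      using openin_continuous_map_preimage[OF h T'(1)] by simp
    then have "eventually (\<lambda>\<epsilon>. h \<epsilon> \<in> T') (at 0)"
      unfolding eventually_at_topological using T T' h0 by (intro exI[of _ "{\<epsilon>. h \<epsilon> \<in> T'}"]) auto
    then have "eventually (\<lambda>\<epsilon>. h \<epsilon> \<in> S \<and> h \<epsilon> \<in> T') (at 0)" using ev by eventually_elim simp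
    then have "\<exists>\<epsilon>. h \<epsilon> \<in> S \<and> h \<epsilon> \<in> T'" by (rule eventually_happens'[OF at_neq_bot])
    then obtain \<epsilon> where "h \<epsilon> \<in> S" "h \<epsilon> \<in> T'" by blast
    then show "\<exists>y. y \<in> S \<and> y \<in> T" using T' \<open>S \<subseteq> cr_dom\<close> by blast
  qed
  then show ?thesis
  proof (rule forall_in_closure_of_eq[OF _ Hausdorff_real_inf f continuous_map_cr])
    fix R assume R: "R \<in> S"
    obtain a b c d where Rabcd: "R = (a, b, c, d)" by (rule prod_cases4)
    have ne: "b \<noteq> c" "b \<noteq> d" "c \<noteq> d" "a \<noteq> d" "{a, b, c, d} \<subseteq> proj_line"
      using R unfolding Rabcd S_def by simp_all
    obtain u v x where uv: "lin_indep2 u v"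
      and R_eq: "(a, b, c, d) = (proj_pt (u + x *\<^sub>R v), proj_pt (u + v), proj_pt u, proj_pt v)"
      by (rule normalised_quadruple[OF ne])
    show "f R = cr R" unfolding Rabcd R_eq norm[OF uv] cr_normalised[OF uv] ..
  qed
qed

text \<open>The left side does not mention the basis, so the coordinate formulas hold in every
  basis, and the basis can later be adapted to \<open>U\<close>. Outside \<open>cr_dom\<close> the
  two functions agree because both are extensional.\<close>

lemma cross_ratio_eq_cr: "cross_ratio = cr"
  unfolding cross_ratio_def
proof (rule the_equality)
  show "cr \<in> extensional cr_dom \<and> continuous_map (subtopology quad_topology cr_dom) real_inf_topology cr \<and>
    (\<forall>e1 e2 x. lin_indep2 e1 e2 \<longrightarrow> cr (proj_pt (e1 + x *\<^sub>R e2), proj_pt (e1 + e2), proj_pt e1, proj_pt e2) = Some x)"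
    by (simp add: continuous_map_cr cr_normalised) (simp add: cr_def)
next
  fix f :: "'a set \<times> 'a set \<times> 'a set \<times> 'a set \<Rightarrow> real option"
  assume f: "f \<in> extensional cr_dom \<and> continuous_map (subtopology quad_topology cr_dom) real_inf_topology f \<and>
    (\<forall>e1 e2 x. lin_indep2 e1 e2 \<longrightarrow> f (proj_pt (e1 + x *\<^sub>R e2), proj_pt (e1 + e2), proj_pt e1, proj_pt e2) = Some x)"
  have "cr \<in> extensional cr_dom" by (simp add: cr_def)
  then show "f = cr"
    using f cr_unique by (intro extensionalityI[of _ cr_dom]) auto
qed

lemmas cross_ratio_vec = cr_vec[folded cross_ratio_eq_cr]

end

section \<open>Arcs\<close>

lemma connected_components_of_two_open:
  assumes "topspace X = S \<union> T" "S \<inter> T = {}" "openin X S" "openin X T"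
    "connectedin X S" "connectedin X T" "S \<noteq> {}" "T \<noteq> {}"
  shows "connected_components_of X = {S, T}"
proof -
  have cmp: "connected_component_of_set X x = S'"
    if S': "x \<in> S'" "connectedin X S'" "openin X S'" "closedin X S'" for x S'
  proof
    show "S' \<subseteq> connected_component_of_set X x"
      using S' by (intro connected_component_of_maximal) auto
    have "x \<in> topspace X" using S'(1,3) openin_subset by blast
    then have "\<not> disjnt (connected_component_of_set X x) S'"
      using S'(1) connected_component_of_refl by (fastforce simp: disjnt_iff)
    then show "connected_component_of_set X x \<subseteq> S'"
      using connectedin_clopen_cases[OF connectedin_connected_component_of S'(4,3)] by blast
  qed
  have cl: "closedin X S" "closedin X T"
    using assms(1-4) by (auto simp: closedin_def Diff_triv Un_Diff Int_commute)
  have "connected_components_of X = connected_component_of_set X ` S \<union> connected_component_of_set X ` T"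
    unfolding connected_components_of_def assms(1) by (rule image_Un)
  also have "\<dots> = {S, T}"
    using cmp[OF _ assms(5,3) cl(1)] cmp[OF _ assms(6,4) cl(2)] assms(7,8) by (auto simp: image_constant_conv)
  finally show ?thesis .
qed

context plane_basis
begin

lemma pt_image_shift: "pt ` {\<alpha> + pi<..<\<beta> + pi} = pt ` {\<alpha><..<\<beta>}"
proof (intro set_eqI iffI)
  fix p assume "p \<in> pt ` {\<alpha> + pi<..<\<beta> + pi}"
  then obtain \<theta> where "\<theta> \<in> {\<alpha> + pi<..<\<beta> + pi}" "p = pt \<theta>" by blast
  then show "p \<in> pt ` {\<alpha><..<\<beta>}" by (intro image_eqI[of _ _ "\<theta> - pi"]) auto
next
  fix p assume "p \<in> pt ` {\<alpha><..<\<beta>}"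
  then obtain \<theta> where "\<theta> \<in> {\<alpha><..<\<beta>}" "p = pt \<theta>" by blast
  then show "p \<in> pt ` {\<alpha> + pi<..<\<beta> + pi}" by (intro image_eqI[of _ _ "\<theta> + pi"]) auto
qed

lemma proj_line_Diff_arc:
  assumes "\<alpha> \<le> \<beta>" "\<beta> < \<alpha> + pi"
  shows "proj_line - pt ` {\<alpha>..\<beta>} = pt ` {\<beta><..<\<alpha> + pi}"
proof (intro set_eqI iffI)
  fix p assume p: "p \<in> proj_line - pt ` {\<alpha>..\<beta>}"
  then obtain \<theta> where "\<alpha> \<le> \<theta>" "\<theta> < \<alpha> + pi" "p = pt \<theta>" using pt_cases[of p \<alpha>] by blast
  moreover have "\<not> \<theta> \<le> \<beta>" using p calculation by auto
  ultimately show "p \<in> pt ` {\<beta><..<\<alpha> + pi}" by auto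
next
  fix p assume "p \<in> pt ` {\<beta><..<\<alpha> + pi}"
  then obtain \<theta> where \<theta>: "\<beta> < \<theta>" "\<theta> < \<alpha> + pi" "p = pt \<theta>" by auto
  have "p \<noteq> pt t" if "t \<in> {\<alpha>..\<beta>}" for t
  proof
    assume "p = pt t"
    then have "\<theta> = t" using pt_inj[of \<theta> t] \<theta> that assms by auto
    then show False using \<theta> that by simp
  qed
  then show "p \<in> proj_line - pt ` {\<alpha>..\<beta>}" using \<theta>(3) pt_in_proj_line by blast
qed

lemma proj_line_Diff_pair:
  assumes "\<alpha> < \<beta>" "\<beta> < \<alpha> + pi"
  shows "proj_line - {pt \<alpha>, pt \<beta>} = pt ` {\<alpha><..<\<beta>} \<union> pt ` {\<beta><..<\<alpha> + pi}"
    and "pt ` {\<alpha><..<\<beta>} \<inter> pt ` {\<beta><..<\<alpha> + pi} = {}"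
proof -
  have 1: "proj_line - pt ` {\<alpha>..\<beta>} = pt ` {\<beta><..<\<alpha> + pi}"
    and 2: "proj_line - pt ` {\<beta>..\<alpha> + pi} = pt ` {\<alpha><..<\<beta>}"
    using proj_line_Diff_arc[of \<alpha> \<beta>] proj_line_Diff_arc[of \<beta> "\<alpha> + pi"] assms
    by (simp_all add: pt_image_shift)
  show "pt ` {\<alpha><..<\<beta>} \<inter> pt ` {\<beta><..<\<alpha> + pi} = {}"
    unfolding 2[symmetric] by auto
  have "pt \<alpha> \<notin> pt ` {\<alpha><..<\<beta>}" "pt \<beta> \<notin> pt ` {\<alpha><..<\<beta>}"
    unfolding 2[symmetric] using assms pt_add_pi[of \<alpha>]
    by (auto simp: image_iff intro: bexI[of _ \<beta>] bexI[of _ "\<alpha> + pi"])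
  moreover have "pt \<alpha> \<notin> pt ` {\<beta><..<\<alpha> + pi}" "pt \<beta> \<notin> pt ` {\<beta><..<\<alpha> + pi}"
    unfolding 1[symmetric] using assms by auto
  moreover have "p \<in> pt ` {\<alpha><..<\<beta>} \<union> pt ` {\<beta><..<\<alpha> + pi}"
    if "p \<in> proj_line - {pt \<alpha>, pt \<beta>}" for p
  proof -
    obtain \<theta> where "\<alpha> \<le> \<theta>" "\<theta> < \<alpha> + pi" "p = pt \<theta>" using pt_cases[of p \<alpha>] \<open>p \<in> _\<close> by blast
    moreover have "\<theta> \<noteq> \<alpha>" "\<theta> \<noteq> \<beta>" using that calculation by auto
    ultimately show ?thesis by (cases "\<theta> < \<beta>") auto
  qed
  ultimately show "proj_line - {pt \<alpha>, pt \<beta>} = pt ` {\<alpha><..<\<beta>} \<union> pt ` {\<beta><..<\<alpha> + pi}"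
    using pt_in_proj_line by blast
qed

lemma connectedin_pt_image: "connected S \<Longrightarrow> connectedin proj_topology (pt ` S)"
  by (rule connectedin_continuous_map_image[OF continuous_map_pt]) simp

lemma closure_of_open_arc:
  assumes "\<alpha> < \<beta>"
  shows "proj_topology closure_of (pt ` {\<alpha><..<\<beta>}) = pt ` {\<alpha>..\<beta>}"
proof
  have "compactin proj_topology (pt ` {\<alpha>..\<beta>})"
    by (rule image_compactin[OF _ continuous_map_pt]) simp
  then have "closedin proj_topology (pt ` {\<alpha>..\<beta>})"
    by (rule compactin_imp_closedin[OF Hausdorff_proj])
  then show "proj_topology closure_of (pt ` {\<alpha><..<\<beta>}) \<subseteq> pt ` {\<alpha>..\<beta>}"
    by (intro closure_of_minimal) auto
  show "pt ` {\<alpha>..\<beta>} \<subseteq> proj_topology closure_of (pt ` {\<alpha><..<\<beta>})"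
    using continuous_map_image_closure_subset[OF continuous_map_pt, of "{\<alpha><..<\<beta>}"] assms by simp
qed

lemma closed_arcs_pt:
  assumes "\<alpha> < \<beta>" "\<beta> < \<alpha> + pi"
  shows "closed_arcs (pt \<alpha>) (pt \<beta>) = {pt ` {\<alpha>..\<beta>}, pt ` {\<beta>..\<alpha> + pi}}"
proof -
  let ?X = "subtopology proj_topology (proj_line - {pt \<alpha>, pt \<beta>})"
  let ?S = "pt ` {\<alpha><..<\<beta>}" and ?T = "pt ` {\<beta><..<\<alpha> + pi}"
  note D = proj_line_Diff_pair[OF assms]
  have "connected_components_of ?X = {?S, ?T}"
  proof (rule connected_components_of_two_open)
    show "topspace ?X = ?S \<union> ?T" using D by auto
    show "?S \<inter> ?T = {}" by (rule D)
    have "openin proj_topology ?S" "openin proj_topology ?T" by (simp_all add: openin_pt_image)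
    then show "openin ?X ?S" "openin ?X ?T"
      unfolding D(1) openin_subtopology by blast+
    show "connectedin ?X ?S" "connectedin ?X ?T"
      using D(1) by (auto simp: connectedin_subtopology connectedin_pt_image)
    show "?S \<noteq> {}" "?T \<noteq> {}" using assms by auto
  qed
  then show ?thesis
    unfolding closed_arcs_def using assms by (simp add: closure_of_open_arc)
qed

lemma interior_of_arc:
  assumes "\<alpha> < \<beta>" "\<beta> < \<alpha> + pi"
  shows "proj_topology interior_of (pt ` {\<alpha>..\<beta>}) = pt ` {\<alpha><..<\<beta>}"
proof -
  have "proj_topology interior_of (pt ` {\<alpha>..\<beta>}) = proj_line - pt ` {\<beta>..\<alpha> + pi}"
    using assms by (simp add: interior_of_closure_of proj_line_Diff_arc closure_of_open_arc)
  also have "\<dots> = pt ` {\<alpha><..<\<beta>}"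
    using proj_line_Diff_arc[of \<beta> "\<alpha> + pi"] assms by (simp add: pt_image_shift)
  finally show ?thesis .
qed

text \<open>Only the unordered pair of end points matters to \<open>closed_arcs\<close>. This
  freedom is needed because the arc on the other side runs from \<open>\<beta>\<close> to
  \<open>\<alpha> + pi\<close>, which exchanges the ends.\<close>

lemma arc_of_eq:
  assumes "\<alpha> < \<beta>" "\<beta> < \<alpha> + pi" "{p, q} = {pt \<alpha>, pt \<beta>}" "B p q \<in> pt ` {\<alpha><..<\<beta>}"
  shows "arc_of B p q = pt ` {\<alpha>..\<beta>}"
proof -
  have "closed_arcs p q = closed_arcs (pt \<alpha>) (pt \<beta>)"
    unfolding closed_arcs_def assms(3) ..
  then have ca: "closed_arcs p q = {pt ` {\<alpha>..\<beta>}, pt ` {\<beta>..\<alpha> + pi}}"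
    using closed_arcs_pt[OF assms(1,2)] by simp
  have "B p q \<notin> pt ` {\<beta><..<\<alpha> + pi}"
    using proj_line_Diff_pair(2)[OF assms(1,2)] assms(4) by blast
  then show ?thesis
    unfolding arc_of_def ca
    using assms interior_of_arc[of \<alpha> \<beta>] interior_of_arc[of \<beta> "\<alpha> + pi"]
    by (intro the_equality) auto
qed

lemma arc_of_cases:
  assumes "\<alpha> < \<beta>" "\<beta> < \<alpha> + pi" "{p, q} = {pt \<alpha>, pt \<beta>}" "B p q \<in> proj_line" "B p q \<noteq> p" "B p q \<noteq> q"
  obtains "B p q \<in> pt ` {\<alpha><..<\<beta>}" "arc_of B p q = pt ` {\<alpha>..\<beta>}"
  | "B p q \<in> pt ` {\<beta><..<\<alpha> + pi}" "arc_of B p q = pt ` {\<beta>..\<alpha> + pi}"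
proof -
  have "B p q \<in> proj_line - {pt \<alpha>, pt \<beta>}" using assms(3-6) by (metis Diff_iff insertE singletonD)
  then consider "B p q \<in> pt ` {\<alpha><..<\<beta>}" | "B p q \<in> pt ` {\<beta><..<\<alpha> + pi}"
    using proj_line_Diff_pair(1)[OF assms(1,2)] by auto
  then show thesis
  proof cases
    case 1
    then show thesis using arc_of_eq[OF assms(1-3)] that by blast
  next
    case 2
    moreover have "arc_of B p q = pt ` {\<beta>..\<alpha> + pi}"
      using assms 2 by (intro arc_of_eq) (auto simp: insert_commute)
    ultimately show thesis using that by blast
  qed
qed

end

section \<open>Orientation and the affine coordinate\<close>

context plane_basis
begin

lemma plane_basis_of_indep:
  fixes u v :: 'a
  assumes "lin_indep2 u v"
  shows "plane_basis u v"
proof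
  show "lin_indep2 u v" by fact
  fix w :: 'a
  obtain a b where u: "u = vec a b" by (rule vec_cases)
  obtain c d where v: "v = vec c d" by (rule vec_cases)
  obtain x y where w: "w = vec x y" by (rule vec_cases)
  define D where "D = a * d - b * c"
  have D: "D \<noteq> 0" using assms by (simp add: u v lin_indep2_vec D_def)
  define s t where "s = x * d - y * c" and "t = a * y - b * x"
  have "s * a + t * c = x * D" "s * b + t * d = y * D"
    by (simp_all add: D_def s_def t_def algebra_simps)
  moreover have "s / D * a' + t / D * c' = (s * a' + t * c') / D" for a' c'
    by (simp add: add_divide_distrib)
  ultimately have "w = (s / D) *\<^sub>R u + (t / D) *\<^sub>R v"
    unfolding u v w vec_scale vec_add vec_eq_iff using D by simp
  then show "\<exists>x y. w = x *\<^sub>R u + y *\<^sub>R v" by blast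
qed

text \<open>A shift of one angle by \<open>pi\<close> changes the signs of the two sines in which it
  occurs and leaves the product alone, so the criterion depends on the points only. For angles
  within one period starting at \<open>\<alpha>\<close> the signs can be read off.\<close>

lemma pos_cyclic_pt_iff:
  "pos_cyclic e1 e2 (pt \<alpha>) (pt \<beta>) (pt \<gamma>) \<longleftrightarrow> sin (\<beta> - \<alpha>) * sin (\<gamma> - \<beta>) * sin (\<alpha> - \<gamma>) < 0"
proof -
  have invariant: "sin (\<beta> - \<alpha>) * sin (\<gamma> - \<beta>) * sin (\<alpha> - \<gamma>) =
      sin (\<beta>' - \<alpha>') * sin (\<gamma>' - \<beta>') * sin (\<alpha>' - \<gamma>')"
    if "pt \<alpha> = pt \<alpha>'" "pt \<beta> = pt \<beta>'" "pt \<gamma> = pt \<gamma>'" for \<alpha>' \<beta>' \<gamma>'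
  proof -
    define x y z where "x = \<alpha> - \<alpha>'" and "y = \<beta> - \<beta>'" and "z = \<gamma> - \<gamma>'"
    have s: "sin x = 0" "sin y = 0" "sin z = 0"
      using that by (simp_all add: pt_eq_iff_sin x_def y_def z_def)
    have c: "cos x * cos x = 1" "cos y * cos y = 1" "cos z * cos z = 1"
      using sin_cos_squared_add3[of x] sin_cos_squared_add3[of y] sin_cos_squared_add3[of z] s by auto
    have shift: "sin (t + u - w) = sin t * (cos u * cos w)" if "sin u = 0" "sin w = 0" for t u w :: real
      using that by (simp add: sin_diff sin_add cos_add)
    have "sin (\<beta> - \<alpha>) = sin (\<beta>' - \<alpha>') * (cos y * cos x)"
      "sin (\<gamma> - \<beta>) = sin (\<gamma>' - \<beta>') * (cos z * cos y)"
      "sin (\<alpha> - \<gamma>) = sin (\<alpha>' - \<gamma>') * (cos x * cos z)"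
      using shift[OF s(2,1), of "\<beta>' - \<alpha>'"] shift[OF s(3,2), of "\<gamma>' - \<beta>'"]
        shift[OF s(1,3), of "\<alpha>' - \<gamma>'"]
      by (simp_all add: x_def y_def z_def)
    then have "sin (\<beta> - \<alpha>) * sin (\<gamma> - \<beta>) * sin (\<alpha> - \<gamma>) =
        (sin (\<beta>' - \<alpha>') * sin (\<gamma>' - \<beta>') * sin (\<alpha>' - \<gamma>')) *
        ((cos x * cos x) * (cos y * cos y) * (cos z * cos z))"
      by (simp only: ac_simps)
    then show ?thesis unfolding c by simp
  qed
  have pos: "pos_cyclic e1 e2 (pt \<alpha>) (pt \<beta>) (pt \<gamma>) \<longleftrightarrow>
      (\<exists>\<alpha>' \<beta>' \<gamma>'. \<alpha>' < \<beta>' \<and> \<beta>' < \<gamma>' \<and> \<gamma>' < \<alpha>' + pi \<and>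
        pt \<alpha> = pt \<alpha>' \<and> pt \<beta> = pt \<beta>' \<and> pt \<gamma> = pt \<gamma>')"
    unfolding pos_cyclic_def by (simp add: pt_def vec_def)
  show ?thesis
  proof
    assume "pos_cyclic e1 e2 (pt \<alpha>) (pt \<beta>) (pt \<gamma>)"
    then obtain \<alpha>' \<beta>' \<gamma>' where o: "\<alpha>' < \<beta>'" "\<beta>' < \<gamma>'" "\<gamma>' < \<alpha>' + pi" and
      e: "pt \<alpha> = pt \<alpha>'" "pt \<beta> = pt \<beta>'" "pt \<gamma> = pt \<gamma>'"
      unfolding pos by blast
    have "sin (\<beta>' - \<alpha>') > 0" "sin (\<gamma>' - \<beta>') > 0" "sin (\<gamma>' - \<alpha>') > 0"
      using o by (auto intro!: sin_gt_zero)
    moreover have "sin (\<alpha>' - \<gamma>') = - sin (\<gamma>' - \<alpha>')"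
      using sin_minus[of "\<gamma>' - \<alpha>'"] by simp
    ultimately show "sin (\<beta> - \<alpha>) * sin (\<gamma> - \<beta>) * sin (\<alpha> - \<gamma>) < 0"
      unfolding invariant[OF e] by (simp add: mult_pos_neg)
  next
    assume neg: "sin (\<beta> - \<alpha>) * sin (\<gamma> - \<beta>) * sin (\<alpha> - \<gamma>) < 0"
    obtain \<beta>' where b: "\<alpha> \<le> \<beta>'" "\<beta>' < \<alpha> + pi" "pt \<beta> = pt \<beta>'" using pt_cases[of "pt \<beta>" \<alpha>] by auto
    obtain \<gamma>' where g: "\<alpha> \<le> \<gamma>'" "\<gamma>' < \<alpha> + pi" "pt \<gamma> = pt \<gamma>'" using pt_cases[of "pt \<gamma>" \<alpha>] by auto
    have neg': "sin (\<beta>' - \<alpha>) * sin (\<gamma>' - \<beta>') * sin (\<alpha> - \<gamma>') < 0"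
      using neg invariant[OF refl b(3) g(3)] by simp
    have "\<alpha> \<noteq> \<beta>'" "\<beta>' \<noteq> \<gamma>'" "\<alpha> \<noteq> \<gamma>'" using neg' by auto
    have pos1: "sin (\<beta>' - \<alpha>) > 0" "sin (\<gamma>' - \<alpha>) > 0"
      using b g \<open>\<alpha> \<noteq> \<beta>'\<close> \<open>\<alpha> \<noteq> \<gamma>'\<close> by (auto intro!: sin_gt_zero)
    have "sin (\<alpha> - \<gamma>') = - sin (\<gamma>' - \<alpha>)" using sin_minus[of "\<gamma>' - \<alpha>"] by simp
    then have "0 < sin (\<gamma>' - \<beta>')"
      using neg' pos1 by (simp add: zero_less_mult_iff)
    moreover have "sin (\<gamma>' - \<beta>') = - sin (\<beta>' - \<gamma>')" using sin_minus[of "\<beta>' - \<gamma>'"] by simp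
    ultimately have "\<not> \<gamma>' < \<beta>'" using sin_gt_zero[of "\<beta>' - \<gamma>'"] b g by auto
    then have "\<beta>' < \<gamma>'" using \<open>\<beta>' \<noteq> \<gamma>'\<close> by simp
    then show "pos_cyclic e1 e2 (pt \<alpha>) (pt \<beta>) (pt \<gamma>)"
      unfolding pos using b g \<open>\<alpha> \<noteq> \<beta>'\<close>
      by (intro exI[of _ \<alpha>] exI[of _ \<beta>'] exI[of _ \<gamma>']) auto
  qed
qed

lemma pos_cyclic_vec_iff:
  assumes nz: "vec a1 a2 \<noteq> 0" "vec b1 b2 \<noteq> 0" "vec c1 c2 \<noteq> 0"
  shows "pos_cyclic e1 e2 (proj_pt (vec a1 a2)) (proj_pt (vec b1 b2)) (proj_pt (vec c1 c2)) \<longleftrightarrow>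
    (a1 * b2 - a2 * b1) * (b1 * c2 - b2 * c1) * (c1 * a2 - c2 * a1) < 0"
proof -
  obtain r \<alpha> where a: "r > 0" "a1 = r * cos \<alpha>" "a2 = r * sin \<alpha>" "proj_pt (vec a1 a2) = pt \<alpha>"
    using polar[OF nz(1)] .
  obtain s \<beta> where b: "s > 0" "b1 = s * cos \<beta>" "b2 = s * sin \<beta>" "proj_pt (vec b1 b2) = pt \<beta>"
    using polar[OF nz(2)] .
  obtain t \<gamma> where c: "t > 0" "c1 = t * cos \<gamma>" "c2 = t * sin \<gamma>" "proj_pt (vec c1 c2) = pt \<gamma>"
    using polar[OF nz(3)] .
  have "(a1 * b2 - a2 * b1) * (b1 * c2 - b2 * c1) * (c1 * a2 - c2 * a1) =
    (r * s * t)\<^sup>2 * (sin (\<beta> - \<alpha>) * sin (\<gamma> - \<beta>) * sin (\<alpha> - \<gamma>))"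
    unfolding a(2,3) b(2,3) c(2,3) sin_diff power2_eq_square by algebra
  moreover have "(r * s * t)\<^sup>2 > 0" using a b c by simp
  ultimately show ?thesis
    unfolding a(4) b(4) c(4) pos_cyclic_pt_iff by (simp add: mult_less_0_iff)
qed

text \<open>The chart of slopes in the basis \<open>e1\<close>, \<open>e2\<close>. Its only missing
  point is the line of \<open>e2\<close>, which is \<open>pt (pi / 2)\<close>.\<close>

definition aff :: "real \<Rightarrow> 'a set" where
  "aff t = proj_pt (vec 1 t)"

lemma aff_in_proj_line [simp]: "aff t \<in> proj_line"
  by (simp add: aff_def proj_pt_in_proj_line)

lemma aff_eq_proj_pt_iff: "vec k c \<noteq> 0 \<Longrightarrow> aff t = proj_pt (vec k c) \<longleftrightarrow> c - k * t = 0"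
  unfolding aff_def by (subst proj_pt_vec_eq_iff) (auto simp: mult.commute)

lemma aff_eq_iff [simp]: "aff s = aff t \<longleftrightarrow> s = t"
  unfolding aff_def by (subst proj_pt_vec_eq_iff) auto

lemma aff_eq_pt: "aff t = pt (arctan t)"
proof -
  have "tan (arctan t) = t" by (rule tan_arctan)
  then have "sin (arctan t) = t * cos (arctan t)"
    by (simp add: tan_def nonzero_divide_eq_eq del: tan_arctan)
  then show ?thesis
    unfolding aff_def pt_def by (subst proj_pt_vec_eq_iff[OF _ vec_cos_sin_nz]) auto
qed

lemma pt_eq_aff: "- (pi / 2) < \<theta> \<Longrightarrow> \<theta> < pi / 2 \<Longrightarrow> pt \<theta> = aff (tan \<theta>)"
  by (simp add: aff_eq_pt arctan_tan)

lemma continuous_map_aff: "continuous_map euclideanreal proj_topology aff"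
proof -
  have "continuous_map euclideanreal euclideanreal arctan"
    by (auto intro!: continuous_intros)
  from continuous_map_compose[OF this continuous_map_pt] show ?thesis
    by (simp add: o_def aff_eq_pt[abs_def])
qed

lemma openin_aff_image:
  assumes "open T"
  shows "openin proj_topology (aff ` T)"
proof -
  have "open ({- (pi / 2)<..<pi / 2} \<inter> tan -` T)"
    using cos_gt_zero_pi
    by (intro continuous_open_preimage assms continuous_intros) fastforce+
  also have "{- (pi / 2)<..<pi / 2} \<inter> tan -` T = arctan ` T"
  proof (intro set_eqI iffI)
    fix x assume "x \<in> {- (pi / 2)<..<pi / 2} \<inter> tan -` T"
    then show "x \<in> arctan ` T" by (intro image_eqI[of _ _ "tan x"]) (auto simp: arctan_tan)
  next
    fix x assume "x \<in> arctan ` T"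
    then show "x \<in> {- (pi / 2)<..<pi / 2} \<inter> tan -` T"
      using arctan_bounded tan_arctan by auto
  qed
  finally have "openin proj_topology (pt ` arctan ` T)" by (rule openin_pt_image)
  then show ?thesis by (simp add: image_image aff_eq_pt)
qed

text \<open>\<open>\<delta>\<close> is the cube of the determinant of the change of basis.\<close>

lemma pos_cyclic_aff_iff:
  fixes u v :: 'a
  assumes "lin_indep2 u v"
  obtains \<delta> where "\<And>r s t. pos_cyclic u v (aff r) (aff s) (aff t) \<longleftrightarrow> \<delta> * ((s - r) * (t - s) * (r - t)) < 0"
proof -
  interpret E: plane_basis u v by (rule plane_basis_of_indep[OF assms])
  obtain a b where 1: "e1 = E.vec a b" by (rule E.vec_cases)
  obtain c d where 2: "e2 = E.vec c d" by (rule E.vec_cases)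
  define D where "D = a * d - b * c"
  have vec_E: "vec 1 t = E.vec (a + t * c) (b + t * d)" for t
  proof -
    have "E.vec (a + t * c) (b + t * d) = E.vec a b + t *\<^sub>R E.vec c d"
      by (simp add: E.vec_scale E.vec_add)
    then show ?thesis by (simp add: vec_def 1[symmetric] 2[symmetric])
  qed
  have aff: "aff t = proj_pt (E.vec (a + t * c) (b + t * d))" for t
    by (simp only: aff_def vec_E)
  have nz: "E.vec (a + t * c) (b + t * d) \<noteq> 0" for t
    using vec_E[of t] by (metis vec_eq_0_iff zero_neq_one)
  have "(a + s * c) * (b + t * d) - (b + s * d) * (a + t * c) = D * (t - s)" for s t
    by (simp add: D_def algebra_simps)
  then have "pos_cyclic u v (aff r) (aff s) (aff t) \<longleftrightarrow> (D * D * D) * ((s - r) * (t - s) * (r - t)) < 0" for r s t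
    unfolding aff E.pos_cyclic_vec_iff[OF nz nz nz] by (simp add: mult.assoc mult.left_commute)
  then show thesis by (rule that)
qed

text \<open>The fourth point stays in homogeneous coordinates because the index \<open>q\<close> of
  \<open>r_q\<close> may be the point at infinity, where \<open>k = 0\<close>. The expression
  \<open>c - k * t\<close> vanishes exactly when \<open>aff t\<close> is that point.\<close>

lemma cross_ratio_aff:
  assumes "vec k c \<noteq> 0" "(aff x, aff y, aff z, proj_pt (vec k c)) \<in> cr_dom"
  shows "cross_ratio (aff x, aff y, aff z, proj_pt (vec k c)) =
    (if (c - k * x) * (z - y) = 0 then None
     else Some ((z - x) * (c - k * y) / ((c - k * x) * (z - y))))"
  using cross_ratio_vec[of 1 x 1 y 1 z k c] assms unfolding aff_def
  by (simp add: mult.commute)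

end

section \<open>Chord slopes on an interval\<close>

text \<open>\<open>quad\<close> is (H6) after clearing denominators and cancelling the common factor
  \<open>b r s - b p q\<close>; its seven inequations say that both cross-ratios are defined and
  neither 0 nor infinite.\<close>

locale chord_slopes =
  fixes I :: "real set" and b :: "real \<Rightarrow> real \<Rightarrow> real"
  assumes open_I: "open I"
    and interval: "x \<in> I \<Longrightarrow> y \<in> I \<Longrightarrow> x \<le> z \<Longrightarrow> z \<le> y \<Longrightarrow> z \<in> I"
    and sym: "x \<in> I \<Longrightarrow> y \<in> I \<Longrightarrow> b x y = b y x"
    and diag: "x \<in> I \<Longrightarrow> b x x = x"
    and between: "x \<in> I \<Longrightarrow> y \<in> I \<Longrightarrow> x < y \<Longrightarrow> x < b x y \<and> b x y < y"
    and cont: "continuous_on (I \<times> I) (\<lambda>z. b (fst z) (snd z))"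
    and quad: "\<lbrakk>p \<in> I; q \<in> I; r \<in> I; s \<in> I; b p q \<noteq> b p s; b p q \<noteq> b r s; b p r \<noteq> b p s; b p r \<noteq> b r s;
        b p q \<noteq> b q s; b q r \<noteq> b q s; b q r \<noteq> b r s\<rbrakk> \<Longrightarrow>
        (b p q - b p s) * (b p r - b r s) * (b q r - b q s) =
        (b p q - b q s) * (b q r - b r s) * (b p r - b p s)"
begin

section \<open>From betweenness to injectivity\<close>

lemma continuous_on_b [continuous_intros]:
  assumes "continuous_on S f" "continuous_on S g" "\<And>x. x \<in> S \<Longrightarrow> f x \<in> I" "\<And>x. x \<in> S \<Longrightarrow> g x \<in> I"
  shows "continuous_on S (\<lambda>x. b (f x) (g x))"
proof -
  have "(\<lambda>x. (f x, g x)) ` S \<subseteq> I \<times> I" using assms(3,4) by blast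
  from continuous_on_compose2[OF cont continuous_on_Pair[OF assms(1,2)] this] show ?thesis by simp
qed

lemma between': "x \<in> I \<Longrightarrow> y \<in> I \<Longrightarrow> y < x \<Longrightarrow> y < b x y \<and> b x y < x"
  using between[of y x] sym[of x y] by metis

lemma b_in_I: "x \<in> I \<Longrightarrow> y \<in> I \<Longrightarrow> b x y \<in> I"
  using between[of x y] between'[of x y] diag[of x] interval[of x y "b x y"] interval[of y x "b x y"]
  by (cases x y rule: linorder_cases) auto

lemma b_ne: "x \<in> I \<Longrightarrow> y \<in> I \<Longrightarrow> x \<noteq> y \<Longrightarrow> b x y \<noteq> x \<and> b x y \<noteq> y"
  using between[of x y] between'[of x y] by (cases x y rule: linorder_cases) auto

text \<open>Reversing the line preserves the hypotheses, so a plateau has to be studied only from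
  points on its left.\<close>

lemma reflect: "chord_slopes (uminus ` I) (\<lambda>x y. - b (- x) (- y))"
proof
  show "open (uminus ` I)" by (rule open_negations[OF open_I])
  show "z \<in> uminus ` I" if "x \<in> uminus ` I" "y \<in> uminus ` I" "x \<le> z" "z \<le> y" for x y z
    using that interval[of "- y" "- x" "- z"] by (auto simp: image_iff) (metis minus_minus)
  show "- b (- x) (- y) = - b (- y) (- x)" if "x \<in> uminus ` I" "y \<in> uminus ` I" for x y
    using that sym by auto
  show "- b (- x) (- x) = x" if "x \<in> uminus ` I" for x
    using that diag by auto
  show "x < - b (- x) (- y) \<and> - b (- x) (- y) < y" if "x \<in> uminus ` I" "y \<in> uminus ` I" "x < y" for x y
    using that between'[of "- x" "- y"] by auto
  show "continuous_on (uminus ` I \<times> uminus ` I) (\<lambda>z. - b (- fst z) (- snd z))"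
    by (intro continuous_intros) auto
  fix p q r s
  assume "p \<in> uminus ` I" "q \<in> uminus ` I" "r \<in> uminus ` I" "s \<in> uminus ` I"
    "- b (- p) (- q) \<noteq> - b (- p) (- s)" "- b (- p) (- q) \<noteq> - b (- r) (- s)"
    "- b (- p) (- r) \<noteq> - b (- p) (- s)" "- b (- p) (- r) \<noteq> - b (- r) (- s)"
    "- b (- p) (- q) \<noteq> - b (- q) (- s)" "- b (- q) (- r) \<noteq> - b (- q) (- s)"
    "- b (- q) (- r) \<noteq> - b (- r) (- s)"
  then show "(- b (- p) (- q) - - b (- p) (- s)) * (- b (- p) (- r) - - b (- r) (- s)) *
       (- b (- q) (- r) - - b (- q) (- s)) =
       (- b (- p) (- q) - - b (- q) (- s)) * (- b (- q) (- r) - - b (- r) (- s)) *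
       (- b (- p) (- r) - - b (- p) (- s))"
    using quad[of "- p" "- q" "- r" "- s"] by auto argo
qed

text \<open>Constancy of \<open>b s\<close> on \<open>{a..c}\<close> propagates to all \<open>s < a\<close>, by \<open>quad\<close> and connectedness; as \<open>s\<close> tends
  to \<open>a\<close>, this contradicts \<open>b a a = a < b a c\<close>.\<close>

lemma no_plateau_right:
  assumes p0: "p0 \<in> I" "p0 < a" and ac: "a < c" "a \<in> I" "c \<in> I"
    and const: "\<And>t. t \<in> {a..c} \<Longrightarrow> b p0 t = m"
  shows False
proof -
  define J where "J = I \<inter> {..<a}"
  define S where "S = {s \<in> J. \<forall>t\<in>{a..c}. b s t = b s a}"
  have cI: "t \<in> I" if "t \<in> {a..c}" for t using that interval[of a c t] ac by auto
  have connJ: "connected J"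
  proof (intro is_interval_connected, unfold is_interval_1, intro ballI allI impI)
    fix x y z assume "x \<in> J" "y \<in> J" "x \<le> z \<and> z \<le> y"
    then show "z \<in> J" using interval[of x y z] by (auto simp: J_def)
  qed
  have clS: "closedin (top_of_set J) S"
  proof -
    have "S = J \<inter> (\<Inter>t\<in>{a..c}. {s \<in> J. b s t - b s a = 0})"
      using ac by (auto simp: S_def)
    moreover have "closedin (top_of_set J) {s \<in> J. b s t - b s a = 0}" if "t \<in> {a..c}" for t
      by (intro continuous_closedin_preimage_constant continuous_intros)
        (use cI[OF that] ac in \<open>auto simp: J_def\<close>)
    ultimately show ?thesis using ac
      by (auto intro!: closedin_Int closedin_INT)
  qed
  have opS: "openin (top_of_set J) S"
    unfolding openin_contains_ball
  proof (intro conjI ballI)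
    show "S \<subseteq> J" by (auto simp: S_def)
    fix r assume r: "r \<in> S"
    define m where "m = b r a"
    have rI: "r \<in> I" "r < a" using r by (auto simp: S_def J_def)
    have rt: "b r t = m" if "t \<in> {a..c}" for t using r that unfolding S_def m_def by blast
    have m: "r < m" "m < a" using between[of r a] rI ac by (auto simp: m_def)
    \<comment> \<open>Since \<open>\<epsilon>\<close> is at most \<open>a - m\<close>, values
      \<open>b s t\<close> that are \<open>\<epsilon>\<close>-close to \<open>m\<close> stay below
      \<open>a\<close>, whereas \<open>b p q\<close> is at least \<open>a\<close> for
      \<open>p\<close> and \<open>q\<close> in \<open>{a..c}\<close>. This separates the two kinds
      of slopes in \<open>quad\<close>.\<close>
    define \<epsilon> where "\<epsilon> = min (a - m) (m - r)"
    have \<epsilon>: "\<epsilon> > 0" using m by (simp add: \<epsilon>_def)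
    obtain d0 where d0: "d0 > 0" "cball r d0 \<subseteq> I" "cball r d0 \<subseteq> {..<m}"
    proof -
      have "open (I \<inter> {..<m})" by (intro open_Int open_I open_lessThan)
      moreover have "r \<in> I \<inter> {..<m}" using rI m by simp
      ultimately obtain e where "e > 0" "cball r e \<subseteq> I \<inter> {..<m}"
        using open_contains_cball by blast
      then show thesis using that[of e] by blast
    qed
    have "uniformly_continuous_on (cball r d0 \<times> {a..c}) (\<lambda>z. b (fst z) (snd z))"
      using d0 cI by (intro compact_uniformly_continuous compact_Times continuous_on_subset[OF cont]) auto
    then obtain d1 where d1: "d1 > 0" and u:
      "\<And>z z'. z \<in> cball r d0 \<times> {a..c} \<Longrightarrow> z' \<in> cball r d0 \<times> {a..c} \<Longrightarrow> dist z' z < d1 \<Longrightarrow>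
        dist (b (fst z') (snd z')) (b (fst z) (snd z)) < \<epsilon>"
      using \<epsilon> unfolding uniformly_continuous_on_def by metis
    define d where "d = min d0 d1"
    have "s \<in> S" if s: "s \<in> ball r d \<inter> J" for s
    proof -
      have "s \<in> cball r d0" using s by (auto simp: d_def)
      then have sI: "s \<in> I" "s < m" "s < a" using s d0 by (auto simp: J_def)
      have st: "\<bar>b s t - m\<bar> < \<epsilon>" if t: "t \<in> {a..c}" for t
        using u[of "(r, t)" "(s, t)"] s t d0(1) rt[OF t]
        by (simp add: d_def dist_commute dist_Pair_Pair) (simp add: dist_real_def)
      have sr: "b r s < m"
        using between[of r s] between'[of r s] diag[of r] rI sI m
        by (cases r s rule: linorder_cases) auto
      \<comment> \<open>As \<open>b p r\<close> and \<open>b q r\<close> both equal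
        \<open>m\<close>, \<open>quad\<close> collapses to
        \<open>(b p q - m) * (b s p - b s q) = 0\<close>, whose first factor is positive. The
        alternatives with the value \<open>m\<close> are those in which (H6) says nothing.\<close>
      have two: "b s p = b s q \<or> b s p = m \<or> b s q = m" if p: "p \<in> {a..c}" and q: "q \<in> {a..c}" for p q
      proof (rule ccontr)
        assume "\<not> ?thesis"
        then have n: "b s p \<noteq> b s q" "b s p \<noteq> m" "b s q \<noteq> m" by auto
        have pq: "a \<le> b p q"
          using between[of p q] between'[of p q] diag[of p] cI[OF p] cI[OF q] p q
          by (cases p q rule: linorder_cases) auto
        have lt: "b s p < a" "b s q < a" using st[OF p] st[OF q] by (auto simp: \<epsilon>_def)
        have e: "b p s = b s p" "b q s = b s q" "b p r = m" "b q r = m"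
          using sym cI p q sI rI rt by auto
        have "(b p q - b s p) * (m - b r s) * (m - b s q) = (b p q - b s q) * (m - b r s) * (m - b s p)"
          using quad[of p q r s, unfolded e] cI[OF p] cI[OF q] rI sI pq lt n m sr by auto
        then have "(b p q - b s p) * (m - b s q) = (b p q - b s q) * (m - b s p)"
          using sr by simp
        then have "(b p q - m) * (b s p - b s q) = 0" by (simp add: algebra_simps)
        then show False using n pq m by auto
      qed
      \<comment> \<open>Connectedness removes the exceptional value \<open>m\<close>: if
        \<open>b s\<close> differed at \<open>t\<close> and \<open>a\<close>, all its values would
        be among these two and \<open>m\<close>, and a finite connected set is at most a single
        point.\<close>
      have "continuous_on {a..c} (b s)"
        using sI cI by (intro continuous_intros) auto
      then have conn: "connected (b s ` {a..c})" by (intro connected_continuous_image) auto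
      have "b s t = b s a" if t: "t \<in> {a..c}" for t
      proof (rule ccontr)
        assume ne: "b s t \<noteq> b s a"
        have aa: "a \<in> {a..c}" using ac by simp
        have "b s ` {a..c} \<subseteq> {m, b s t, b s a}"
          using two[OF _ t] two[OF _ aa] ne by (auto; metis)
        then have "finite (b s ` {a..c})" by (rule finite_subset) simp
        then obtain k where "b s ` {a..c} \<subseteq> {k}"
          using conn connected_finite_iff_sing by (metis empty_subsetI order_refl)
        then show False using ne t aa by (metis image_subset_iff singletonD)
      qed
      then show "s \<in> S" using s unfolding S_def by blast
    qed
    then show "\<exists>e>0. ball r e \<inter> J \<subseteq> S" using d0 d1 by (intro exI[of _ d]) (auto simp: d_def)
  qed
  have "p0 \<in> S" using p0 const ac by (auto simp: S_def J_def)
  then have SJ: "S = J"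
    using connJ clS opS unfolding connected_clopen by blast
  have sub: "s \<in> I" if "s \<in> {p0..a}" for s using that interval[of p0 a s] p0 ac by auto
  have cl: "closure {p0..<a} = {p0..a}" using p0 by simp
  have "b a c - b a a = 0"
  proof (rule continuous_constant_on_closure[of "{p0..<a}" "\<lambda>s. b s c - b s a"])
    show "continuous_on (closure {p0..<a}) (\<lambda>s. b s c - b s a)"
      unfolding cl by (intro continuous_intros) (use sub ac in auto)
    show "b s c - b s a = 0" if "s \<in> {p0..<a}" for s
    proof -
      have "s \<in> S" unfolding SJ J_def using that sub by auto
      moreover have "c \<in> {a..c}" using ac(1) by simp
      ultimately have "b s c = b s a" unfolding S_def by blast
      then show ?thesis by simp
    qed
    show "a \<in> closure {p0..<a}" unfolding cl using p0 by simp
  qed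
  then show False using between[of a c] diag[of a] ac by auto
qed

text \<open>Points to the right of the plateau are treated by reflection. If \<open>p0\<close> lies
  in it, the value at \<open>p0\<close> forces \<open>m = p0\<close>, but \<open>b p0 t\<close>
  differs from \<open>p0\<close> whenever \<open>t\<close> does.\<close>

lemma no_plateau:
  assumes "p0 \<in> I" "a < c" "a \<in> I" "c \<in> I" "\<And>t. t \<in> {a..c} \<Longrightarrow> b p0 t = m"
  shows False
proof -
  consider "p0 < a" | "c < p0" | "p0 \<in> {a..c}" by force
  then show False
  proof cases
    case 1
    then show False using no_plateau_right[of p0 a c m] assms by blast
  next
    case 2
    interpret R: chord_slopes "uminus ` I" "\<lambda>x y. - b (- x) (- y)" by (rule reflect)
    show False using R.no_plateau_right[of "- p0" "- c" "- a" "- m"] 2 assms by auto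
  next
    case 3
    then have m: "m = p0" using assms(5)[of p0] diag assms(1) by simp
    obtain t where "t \<in> {a..c}" "t \<noteq> p0" using assms(2) by (metis atLeastAtMost_iff less_le order_refl)
    then show False using assms m b_ne[of p0 t] interval[of a c t] by auto
  qed
qed

text \<open>Suppose that two chords from \<open>p\<close> have the same slope \<open>m\<close>. For
  \<open>s\<close> near \<open>q\<close>, \<open>quad\<close> factors and leaves two alternatives,
  \<open>b p s = m\<close> or \<open>b r s = b r q\<close>; one of them holds on a whole interval,
  against \<open>no_plateau\<close>.\<close>

lemma b_inj:
  assumes I: "p \<in> I" "q \<in> I" "r \<in> I" and eq: "b p q = b p r"
  shows "q = r"
proof (rule ccontr)
  assume ne: "q \<noteq> r"
  define m where "m = b p q"
  have m: "b p q = m" "b p r = m" using eq by (auto simp: m_def)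
  have pne: "p \<noteq> q" "p \<noteq> r"
    using b_ne[of p r] b_ne[of p q] diag[of p] I eq ne by force+
  have mne: "m \<noteq> p" "m \<noteq> q" "m \<noteq> r" using b_ne[OF I(1,2) pne(1)] b_ne[OF I(1,3) pne(2)] m by auto
  \<comment> \<open>Otherwise \<open>m\<close> would lie strictly between any two of the three
    distinct points \<open>p\<close>, \<open>q\<close>, \<open>r\<close>, although two of them are
    on the same side of \<open>m\<close>.\<close>
  have qr: "b q r \<noteq> m"
    using m ne pne I between[of p q] between[of p r] between[of q r] between'[of p q] between'[of p r] between'[of q r]
    by (smt (verit))
  have qrne: "b q r \<noteq> q" "b q r \<noteq> r" using b_ne[of q r] I ne by auto
  \<comment> \<open>Inequations that hold at \<open>s = q\<close> and hence near it. The first three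
    are required by \<open>quad\<close>, whose other inequations negate the alternatives of
    \<open>dich\<close>; the last makes the factor \<open>b r s - b q s\<close> nonzero.\<close>
  define N where "N = I \<inter> {s \<in> I. b q s \<noteq> m \<and> b r s \<noteq> m \<and> b q r \<noteq> b q s \<and> b q s \<noteq> b r s}"
  have cq: "continuous_on I (\<lambda>s. b x s)" if "x \<in> I" for x
    by (intro continuous_intros) (use that in auto)
  have opn: "open {s \<in> I. f s \<noteq> g s}" if "continuous_on I f" "continuous_on I g" for f g :: "real \<Rightarrow> real"
  proof -
    have "open (I \<inter> (\<lambda>s. f s - g s) -` (- {0}))"
      using that by (intro continuous_open_preimage open_I continuous_intros) auto
    also have "I \<inter> (\<lambda>s. f s - g s) -` (- {0}) = {s \<in> I. f s \<noteq> g s}" by auto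
    finally show ?thesis .
  qed
  have N_eq: "N = {s \<in> I. b q s \<noteq> m} \<inter> {s \<in> I. b r s \<noteq> m} \<inter> {s \<in> I. b q r \<noteq> b q s} \<inter> {s \<in> I. b q s \<noteq> b r s}"
    by (auto simp: N_def)
  have N: "open N"
    unfolding N_eq by (intro open_Int opn cq I continuous_on_const)
  have qN: "q \<in> N" using I mne qr qrne diag[of q] sym[of q r] by (auto simp: N_def)
  have dich: "b p s = m \<or> b r s = b r q" if s: "s \<in> N" for s
  proof (rule ccontr)
    assume "\<not> ?thesis"
    then have n: "b p s \<noteq> m" "b r s \<noteq> b q r" using sym I by auto
    have "(m - b p s) * (m - b r s) * (b q r - b q s) = (m - b q s) * (b q r - b r s) * (m - b p s)"
      using quad[of p q r s, unfolded m] I s n by (auto simp: N_def)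
    then have "(m - b r s) * (b q r - b q s) = (m - b q s) * (b q r - b r s)"
      using n by simp
    then have "(m - b q r) * (b r s - b q s) = 0" by (simp add: algebra_simps)
    then show False using qr s by (auto simp: N_def)
  qed
  have seg: "\<exists>a c. a < c \<and> {a..c} \<subseteq> T" if T: "open T" "T \<noteq> {}" for T :: "real set"
  proof -
    obtain x where "x \<in> T" using T by blast
    then obtain e where "e > 0" "cball x e \<subseteq> T" using T open_contains_cball by blast
    then show ?thesis by (intro exI[of _ x] exI[of _ "x + e"]) (auto simp: cball_def dist_real_def subset_iff)
  qed
  have NI: "N \<subseteq> I" by (auto simp: N_def)
  show False
  proof (cases "\<forall>s\<in>N. b p s = m")
    case True
    obtain a c where "a < c" "{a..c} \<subseteq> N" using seg[OF N] qN by blast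
    moreover have "a \<in> I" "c \<in> I" using \<open>a < c\<close> \<open>{a..c} \<subseteq> N\<close> NI by force+
    ultimately show False using True NI I by (intro no_plateau[of p a c m]) auto
  next
    case False
    have "open (N \<inter> {s \<in> I. b p s \<noteq> m})"
      by (intro open_Int N opn cq I continuous_intros)
    moreover have "N \<inter> {s \<in> I. b p s \<noteq> m} \<noteq> {}" using False NI by auto
    ultimately obtain a c where ac: "a < c" "{a..c} \<subseteq> N \<inter> {s \<in> I. b p s \<noteq> m}" using seg by blast
    moreover have "a \<in> I" "c \<in> I" using ac NI by force+
    moreover have "b r t = b r q" if "t \<in> {a..c}" for t using dich[of t] ac(2) that by blast
    ultimately show False using no_plateau[of r a c "b r q"] I by blast
  qed
qed

section \<open>Consequences of injectivity: monotonicity and the Menelaus identity\<close>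

lemma b_eq_iff: "p \<in> I \<Longrightarrow> q \<in> I \<Longrightarrow> r \<in> I \<Longrightarrow> b p q = b p r \<longleftrightarrow> q = r"
  using b_inj by blast

lemma b_eq_iff': "p \<in> I \<Longrightarrow> q \<in> I \<Longrightarrow> r \<in> I \<Longrightarrow> b q p = b r p \<longleftrightarrow> q = r"
  using b_eq_iff[of p q r] sym by auto

text \<open>An injective continuous function on an interval is strictly monotone. The interval is
  enlarged to contain \<open>p\<close>, because betweenness compares the values at its ends with
  \<open>p\<close> and thereby decides the direction.\<close>

lemma b_strict_mono:
  assumes "p \<in> I" "q \<in> I" "r \<in> I" "q < r"
  shows "b p q < b p r"
proof -
  define lo hi where "lo = min p q" and "hi = max p r"
  have I: "lo \<in> I" "hi \<in> I" using assms by (auto simp: lo_def hi_def min_def max_def)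
  have sub: "t \<in> I" if "t \<in> {lo..hi}" for t using that interval[OF I] by auto
  have lh: "lo < hi" using assms by (auto simp: lo_def hi_def)
  have c: "continuous_on {lo..hi} (b p)"
    by (intro continuous_intros) (use sub assms in auto)
  have inj: "inj_on (b p) {lo..hi}" using sub assms b_inj by (auto simp: inj_on_def)
  have lohi: "b p lo < b p hi"
  proof -
    have "b p lo \<le> p \<and> (lo < p \<longrightarrow> b p lo < p)"
      using between'[of p q] diag[of p] assms by (cases "q < p") (auto simp: lo_def min_def)
    moreover have "p \<le> b p hi \<and> (p < hi \<longrightarrow> p < b p hi)"
      using between[of p r] diag[of p] assms by (cases "p < r") (auto simp: hi_def max_def)
    moreover have "lo < p \<or> p < hi" using lh by (auto simp: lo_def)
    ultimately show ?thesis by linarith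
  qed
  have "strict_mono_on {lo..hi} (b p)"
  proof -
    have "strict_mono_on {lo..hi} (b p) \<or> strict_antimono_on {lo..hi} (b p)"
      using injective_eq_monotone_map[of "{lo..hi}" "b p"] c inj by auto
    moreover have "\<not> strict_antimono_on {lo..hi} (b p)"
      using lohi lh monotone_onD[of "{lo..hi}" "(<)" "\<lambda>x y. y < x" "b p" lo hi] by auto
    ultimately show ?thesis by blast
  qed
  then show ?thesis using assms by (auto simp: monotone_on_def lo_def hi_def)
qed

text \<open>For coinciding points the identity is immediate. For distinct ones injectivity yields
  all inequations of \<open>quad\<close> except \<open>b p q \<noteq> b r s\<close>; if that one
  fails, every small move of \<open>s\<close> restores it, since \<open>b r\<close> is injective,
  and the identity follows by continuity in \<open>s\<close>.\<close>

lemma menelaus: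
  assumes I: "p \<in> I" "q \<in> I" "r \<in> I" "s \<in> I"
  shows "(b p q - b p s) * (b p r - b r s) * (b q r - b q s) =
         (b p q - b q s) * (b q r - b r s) * (b p r - b p s)"
proof -
  let ?f = "\<lambda>s. (b p q - b p s) * (b p r - b r s) * (b q r - b q s) -
         (b p q - b q s) * (b q r - b r s) * (b p r - b p s)"
  have gen: "?f t = 0" if t: "t \<in> I" "p \<noteq> q" "p \<noteq> r" "q \<noteq> r" "t \<noteq> p" "t \<noteq> q" "t \<noteq> r" "b r t \<noteq> b p q" for t
  proof -
    have "b p q \<noteq> b p t" "b p r \<noteq> b p t" "b q r \<noteq> b q t"
      using t I by (auto simp: b_eq_iff)
    moreover have "b p q \<noteq> b q t" "b p r \<noteq> b r t" "b q r \<noteq> b r t"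
      using t I b_eq_iff sym by metis+
    ultimately show ?thesis using quad[of p q r t] I t by auto
  qed
  show ?thesis
  proof (cases "p = q \<or> p = r \<or> q = r \<or> s = p \<or> s = q \<or> s = r")
    case True
    then show ?thesis using I by (auto simp: sym)
  next
    case False
    show ?thesis
    proof (cases "b r s = b p q")
      case False
      then show ?thesis using gen[of s] I \<open>\<not> (p = q \<or> p = r \<or> q = r \<or> s = p \<or> s = q \<or> s = r)\<close> by auto
    next
      case True
      let ?N = "I - {p, q, r}"
      have N: "open ?N" "s \<in> ?N" using I open_I \<open>\<not> (p = q \<or> p = r \<or> q = r \<or> s = p \<or> s = q \<or> s = r)\<close> by auto
      have c: "continuous_on ?N ?f" by (intro continuous_intros) (use I in auto)
      have z: "?f t = 0" if "t \<in> ?N - {s}" for t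
      proof (rule gen)
        show "b r t \<noteq> b p q" using that True b_eq_iff[of r t s] I by auto
      qed (use that \<open>\<not> (p = q \<or> p = r \<or> q = r \<or> s = p \<or> s = q \<or> s = r)\<close> in auto)
      have "(?f \<longlongrightarrow> ?f s) (at s)"
        using c N by (simp only: continuous_on_eq_continuous_at continuous_at)
      moreover have "eventually (\<lambda>t. ?f t = 0) (at s)"
        unfolding eventually_at_topological using N z by (intro exI[of _ ?N]) blast
      ultimately have "((\<lambda>t. 0) \<longlongrightarrow> ?f s) (at s)" by (rule Lim_transform_eventually)
      then have "?f s = 0" by (simp add: tendsto_const_iff)
      then show ?thesis by simp
    qed
  qed
qed

text \<open>The weight \<open>w\<close> for which
  \<open>b x z = (1 - w) * b x y + w * b y z\<close>. On the curve it is the abscissa of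
  \<open>y\<close>, normalised to be 1 at \<open>x\<close> and 0 at \<open>z\<close>.\<close>

definition rho :: "real \<Rightarrow> real \<Rightarrow> real \<Rightarrow> real" where
  "rho x y z = (b x z - b x y) / (b y z - b x y)"

text \<open>Cross-multiplied, this is \<open>menelaus\<close>; the two inequations keep the
  denominators nonzero.\<close>

lemma rho_mult:
  assumes I: "x \<in> I" "y \<in> I" "z \<in> I" "t \<in> I" and ne: "x \<noteq> t" "y \<noteq> t"
  shows "rho x y t * rho y z t = rho x z t"
proof -
  have d: "b y t - b x y \<noteq> 0" "b z t - b y z \<noteq> 0" "b z t - b x z \<noteq> 0"
    using I ne b_eq_iff sym by (metis diff_eq_diff_eq diff_self)+
  have "(b x t - b x y) * (b y t - b y z) * (b z t - b x z) = (b x t - b x z) * (b y t - b x y) * (b z t - b y z)"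
    using menelaus[OF I] by algebra
  then show ?thesis using d unfolding rho_def times_divide_times_eq by (subst frac_eq_eq) auto
qed

lemma rho_swap:
  assumes I: "x \<in> I" "y \<in> I" "z \<in> I" and ne: "x \<noteq> z"
  shows "rho z y x = 1 - rho x y z"
proof -
  have "b y z - b x y \<noteq> 0" using I ne b_eq_iff sym by (metis diff_eq_diff_eq diff_self)
  moreover have "b z x = b x z" "b z y = b y z" "b y x = b x y" using sym I by auto
  ultimately show ?thesis by (simp add: rho_def divide_simps) (simp add: algebra_simps)
qed

lemma rho_end [simp]: "x \<in> I \<Longrightarrow> z \<in> I \<Longrightarrow> rho x z z = 0"
  by (simp add: rho_def)

lemma rho_start [simp]:
  assumes "x \<in> I" "z \<in> I" "x \<noteq> z"
  shows "rho x x z = 1"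
proof -
  have "b x z \<noteq> b x x" using assms b_eq_iff[of x z x] by auto
  then show ?thesis by (simp add: rho_def)
qed

text \<open>The quotient of two differences of abscissas, that of \<open>x\<close> and
  \<open>y\<close> by that of \<open>u\<close> and \<open>v\<close>; it is \<open>d_q\<close> for
  \<open>q\<close> at infinity.\<close>

definition kappa :: "real \<Rightarrow> real \<Rightarrow> real \<Rightarrow> real \<Rightarrow> real" where
  "kappa x y u v = rho u x v - rho u y v"

text \<open>The function \<open>\<lambda>x. rho w x z\<close> is an affine coordinate of the curve, up to which \<open>rho u x v\<close> is
  the ratio of two differences.\<close>

lemma rho_affine:
  assumes I: "u \<in> I" "x \<in> I" "v \<in> I" "w \<in> I" "z \<in> I" and ne: "u \<noteq> v" "w \<noteq> z"
  shows "rho u x v * (rho w u z - rho w v z) = rho w x z - rho w v z"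
proof (cases "v = z")
  case True
  then show ?thesis using rho_mult[of w u x z] I ne by (simp add: mult.commute)
next
  case False
  \<comment> \<open>Both differences are rewritten with the common factor \<open>- rho w v z\<close>
    and with the zero of the coordinate moved from \<open>z\<close> to \<open>v\<close>, where
    \<open>rho_mult\<close> compares them.\<close>
  have "rho w v z * rho v x z = rho w x z" using rho_mult[of w v x z] I ne False by simp
  then have 1: "rho w x z - rho w v z = - rho w v z * rho z x v"
    using rho_swap[of v x z] I False by (simp add: right_diff_distrib)
  have "rho w v z * rho v u z = rho w u z" using rho_mult[of w v u z] I ne False by simp
  then have 2: "rho w u z - rho w v z = - rho w v z * rho z u v"
    using rho_swap[of v u z] I False by (simp add: right_diff_distrib)
  have "rho z u v * rho u x v = rho z x v" using rho_mult[of z u x v] I ne False by simp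
  then show ?thesis unfolding 1 2 by (simp add: algebra_simps)
qed

lemma kappa_mult:
  assumes "x \<in> I" "y \<in> I" "u \<in> I" "v \<in> I" "w \<in> I" "z \<in> I" "u \<noteq> v" "w \<noteq> z"
  shows "kappa x y u v * kappa u v w z = kappa x y w z"
  using rho_affine[of u x v w z] rho_affine[of u y v w z] assms by (simp add: kappa_def algebra_simps)

lemma kappa_nz:
  assumes "x \<in> I" "y \<in> I" "u \<in> I" "v \<in> I" "u \<noteq> v" "x \<noteq> y"
  shows "kappa x y u v \<noteq> 0"
proof -
  have "kappa x y u v * kappa u v x y = 1"
    using kappa_mult[of x y u v x y] assms by (simp add: kappa_def)
  then show ?thesis by auto
qed

text \<open>Up to a common factor, \<open>rho u x v * (c - k * b x v)\<close> is the change along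
  the chord from \<open>v\<close> to \<open>x\<close> of \<open>c\<close> times the abscissa minus
  \<open>k\<close> times the ordinate; such changes add up around the triangle \<open>x\<close>,
  \<open>y\<close>, \<open>v\<close>. The coefficient of \<open>c\<close> is the definition of
  \<open>kappa\<close>, that of \<open>k\<close> is \<open>menelaus\<close>.\<close>

lemma kappa_slope:
  assumes I: "x \<in> I" "y \<in> I" "u \<in> I" "v \<in> I" and ne: "u \<noteq> v"
  shows "rho u x v * (c - k * b x v) - rho u y v * (c - k * b y v) = kappa x y u v * (c - k * b x y)"
proof -
  have d: "b x v - b u x \<noteq> 0" "b y v - b u y \<noteq> 0"
    using I ne b_eq_iff sym by (metis diff_eq_diff_eq diff_self)+
  have "(b x y - b x v) * (b u x - b u v) * (b u y - b y v) = (b x y - b y v) * (b u y - b u v) * (b u x - b x v)"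
    using menelaus[of x y u v] I sym by (metis)
  then have "(b u v - b u x) * (b x y - b x v) * (b y v - b u y) = (b u v - b u y) * (b x y - b y v) * (b x v - b u x)"
    by (simp add: algebra_simps)
  then have "rho u x v * (b x y - b x v) = rho u y v * (b x y - b y v)"
    using d by (simp add: rho_def field_simps)
  then have "k * (rho u x v * (b x y - b x v)) = k * (rho u y v * (b x y - b y v))" by simp
  then show ?thesis by (simp add: kappa_def algebra_simps)
qed

end

section \<open>Chord maps on the projective line\<close>

text \<open>The hypotheses on \<open>D\<close> and \<open>B\<close> do not involve the basis, so the
  same data can be read in a second basis once a point outside \<open>U\<close> is known.\<close>

locale chord_map = plane_basis e1 e2
  for e1 e2 :: "'a::real_vector" +
  fixes D :: "('a set \<times> 'a set) set" and B :: "'a set \<Rightarrow> 'a set \<Rightarrow> 'a set"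
  assumes D_nonempty: "D \<noteq> {}"
    and D_open: "openin (prod_topology proj_topology proj_topology) D"
    and B_map: "(p, q) \<in> D \<Longrightarrow> B p q \<in> proj_line"
    and H1: "(p, q) \<in> D \<Longrightarrow> (q, p) \<in> D"
    and H2: "(p, q) \<in> D \<Longrightarrow> (r, s) \<in> D \<Longrightarrow> (p, r) \<in> D"
    and H3: "(p, q) \<in> D \<Longrightarrow> B p q = B q p"
    and H4: "(p, q) \<in> D \<Longrightarrow> p \<noteq> q \<Longrightarrow> p \<noteq> B p q \<and> B p q \<noteq> q"
    and H5: "(p, q) \<in> D \<Longrightarrow> p \<noteq> q \<Longrightarrow>
        r \<in> proj_topology interior_of (arc_of B p q) \<Longrightarrow>
        s \<in> proj_topology interior_of (arc_of B p q) \<Longrightarrow> r \<noteq> s \<Longrightarrow>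
        (r, s) \<in> D \<and> arc_of B r s \<subseteq> arc_of B p q"
    and H6: "{(p, q), (p, r), (p, s), (q, r), (q, s), (r, s)} \<subseteq> D \<Longrightarrow>
        (B p q, B p r, B p s, B r s) \<in> cr_case (Some 0) \<inter> cr_case None \<Longrightarrow>
        (B p q, B q r, B q s, B r s) \<in> cr_case (Some 0) \<inter> cr_case None \<Longrightarrow>
        cross_ratio (B p q, B p r, B p s, B r s) = cross_ratio (B p q, B q r, B q s, B r s)"
    and H7: "continuous_map (subtopology (prod_topology proj_topology proj_topology) D)
        proj_topology (\<lambda>(p, q). B p q)"
begin

section \<open>The set \<open>U\<close> and the arcs contained in it\<close>

definition U :: "'a set set" where
  "U = {p. (p, p) \<in> D}"

lemma D_eq: "D = U \<times> U"
proof -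
  have "(p, q) \<in> D \<longleftrightarrow> p \<in> U \<and> q \<in> U" for p q
    unfolding U_def using H1 H2 by blast
  then show ?thesis by auto
qed

lemma D_iff [simp]: "(p, q) \<in> D \<longleftrightarrow> p \<in> U \<and> q \<in> U"
  by (subst D_eq) simp

lemma U_nonempty: "U \<noteq> {}"
  using D_nonempty D_iff by (metis empty_iff equals0I surj_pair)

lemma U_subset: "U \<subseteq> proj_line"
proof
  fix p assume "p \<in> U"
  then show "p \<in> proj_line" using subsetD[OF openin_subset[OF D_open], of "(p, p)"] by simp
qed

lemma openin_U: "openin proj_topology U"
proof -
  have "continuous_map proj_topology (prod_topology proj_topology proj_topology) (\<lambda>p :: 'a set. (p, p))"
    by (intro continuous_map_pairedI) auto
  from openin_continuous_map_preimage[OF this D_open]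
  have "openin proj_topology {p \<in> proj_line. p \<in> U}" by simp
  moreover have "{p \<in> proj_line. p \<in> U} = U" using U_subset by blast
  ultimately show ?thesis by simp
qed

lemma B_in_proj_line: "p \<in> U \<Longrightarrow> q \<in> U \<Longrightarrow> B p q \<in> proj_line"
  using B_map by simp

lemma B_sym: "p \<in> U \<Longrightarrow> q \<in> U \<Longrightarrow> B p q = B q p"
  using H3 by simp

lemma continuous_map_B:
  assumes "continuous_map X proj_topology f" "continuous_map X proj_topology g"
    "\<And>x. x \<in> topspace X \<Longrightarrow> f x \<in> U" "\<And>x. x \<in> topspace X \<Longrightarrow> g x \<in> U"
  shows "continuous_map X proj_topology (\<lambda>x. B (f x) (g x))"
proof -
  have "continuous_map X (subtopology (prod_topology proj_topology proj_topology) D) (\<lambda>x. (f x, g x))"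
    unfolding continuous_map_in_subtopology using assms by (auto intro: continuous_map_pairedI)
  from continuous_map_compose[OF this H7] show ?thesis by (simp add: o_def)
qed

text \<open>Whichever arc is selected, it is the image of an interval of angles shorter than
  \<open>pi\<close>. On the far side this interval starts at the other end point, so the order of
  \<open>p\<close> and \<open>q\<close> is given up.\<close>

lemma arc_param:
  assumes "p \<in> U" "q \<in> U" "p \<noteq> q"
  obtains \<alpha> \<beta> where "\<alpha> < \<beta>" "\<beta> < \<alpha> + pi" "{p, q} = {pt \<alpha>, pt \<beta>}" "arc_of B p q = pt ` {\<alpha>..\<beta>}"
    "B p q \<in> pt ` {\<alpha><..<\<beta>}" "proj_topology interior_of (arc_of B p q) = pt ` {\<alpha><..<\<beta>}"
proof -
  obtain \<alpha> where a: "p = pt \<alpha>" using assms U_subset proj_line_eq_range_pt by blast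
  have "q \<in> proj_line" using assms U_subset by blast
  then obtain \<beta> where b: "\<alpha> \<le> \<beta>" "\<beta> < \<alpha> + pi" "q = pt \<beta>" by (rule pt_cases)
  have ab: "\<alpha> < \<beta>" using assms(3) a b by (cases "\<alpha> = \<beta>") auto
  have B: "B p q \<in> proj_line" "B p q \<noteq> p" "B p q \<noteq> q"
    using H4[of p q] assms B_in_proj_line by auto
  have pq: "{p, q} = {pt \<alpha>, pt \<beta>}" using a b by simp
  from ab b(2) pq B show thesis
  proof (cases rule: arc_of_cases)
    case 1
    then show thesis using that[of \<alpha> \<beta>] ab b pq by (simp add: interior_of_arc)
  next
    case 2
    have "{p, q} = {pt \<beta>, pt (\<alpha> + pi)}" using pq by auto
    then show thesis using that[of \<beta> "\<alpha> + pi"] 2 ab b by (simp add: interior_of_arc)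
  qed
qed

lemma arc_subset_U:
  assumes "p \<in> U" "q \<in> U" "p \<noteq> q"
  shows "arc_of B p q \<subseteq> U"
proof
  fix x assume x: "x \<in> arc_of B p q"
  obtain \<alpha> \<beta> where ab: "\<alpha> < \<beta>" "\<beta> < \<alpha> + pi" "{p, q} = {pt \<alpha>, pt \<beta>}" "arc_of B p q = pt ` {\<alpha>..\<beta>}"
    "proj_topology interior_of (arc_of B p q) = pt ` {\<alpha><..<\<beta>}"
    using arc_param[OF assms] by metis
  obtain t where t: "\<alpha> \<le> t" "t \<le> \<beta>" "x = pt t" using x ab(4) by auto
  show "x \<in> U"
  proof (cases "t = \<alpha> \<or> t = \<beta>")
    case True
    then have "x \<in> {p, q}" using t ab(3) by auto
    then show ?thesis using assms by auto
  next
    case False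
    \<comment> \<open>(H5) speaks of two distinct interior points, so the interior point
      \<open>x\<close> is given a companion.\<close>
    define s where "s = (\<alpha> + t) / 2"
    have "\<alpha> < t" "t < \<beta>" using t False by auto
    moreover have "2 * s = \<alpha> + t" by (simp add: s_def)
    ultimately have st: "s < t" "\<alpha> < s" "s < \<beta>" by linarith+
    have "t < s + pi" using \<open>2 * s = \<alpha> + t\<close> \<open>t < \<beta>\<close> ab(2) pi_gt_zero by linarith
    then have "pt s \<noteq> x" using st pt_inj[of s t] t by auto
    moreover have "pt s \<in> pt ` {\<alpha><..<\<beta>}" "x \<in> pt ` {\<alpha><..<\<beta>}"
      using \<open>\<alpha> < s\<close> \<open>s < \<beta>\<close> t False by auto
    ultimately show ?thesis using H5[of p q x "pt s"] assms ab(5) by auto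
  qed
qed

text \<open>\<open>U\<close> is the union of the arcs that join one of its points to the
  others.\<close>

lemma connectedin_U: "connectedin proj_topology U"
proof -
  obtain p where p: "p \<in> U" using U_nonempty by blast
  let ?\<A> = "insert {p} (arc_of B p ` (U - {p}))"
  have arcs: "connectedin proj_topology (arc_of B p q) \<and> p \<in> arc_of B p q \<and> q \<in> arc_of B p q"
    if "q \<in> U - {p}" for q
  proof -
    have "q \<in> U" "p \<noteq> q" using that by auto
    then obtain \<alpha> \<beta> where ab: "\<alpha> < \<beta>" "{p, q} = {pt \<alpha>, pt \<beta>}" "arc_of B p q = pt ` {\<alpha>..\<beta>}"
      using arc_param[OF p] by metis
    have "pt \<alpha> \<in> pt ` {\<alpha>..\<beta>}" "pt \<beta> \<in> pt ` {\<alpha>..\<beta>}" using ab(1) by auto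
    moreover have "p \<in> {pt \<alpha>, pt \<beta>}" "q \<in> {pt \<alpha>, pt \<beta>}" using ab(2) by blast+
    ultimately show ?thesis unfolding ab(3) by (auto simp: connectedin_pt_image)
  qed
  have "connectedin proj_topology (\<Union>?\<A>)"
  proof (rule connectedin_Union)
    show "connectedin proj_topology S" if "S \<in> ?\<A>" for S
      using that arcs p U_subset by auto
    have "p \<in> \<Inter>?\<A>" using arcs by auto
    then show "\<Inter>?\<A> \<noteq> {}" by blast
  qed
  moreover have "\<Union>?\<A> = U"
  proof
    show "\<Union>?\<A> \<subseteq> U" using arc_subset_U[OF p] p by auto
    show "U \<subseteq> \<Union>?\<A>" using arcs by blast
  qed
  ultimately show ?thesis by simp
qed

text \<open>If \<open>U\<close> were the whole circle, then, for fixed \<open>p\<close>, the arc from \<open>p\<close> to \<open>q\<close> would by continuity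
  keep its side as \<open>q\<close> runs through the complement of \<open>p\<close>. On either side, letting \<open>q\<close> approach \<open>p\<close>, these arcs
  exhaust the complement of \<open>p\<close>, so the arc of \<open>r\<close> and \<open>s\<close> would avoid every third point \<open>p\<close>.\<close>

lemma arc_of_proj_line:
  assumes U: "U = proj_line" and rs: "\<rho> < \<sigma>" "\<sigma> < \<rho> + pi"
  shows "B (pt \<rho>) (pt \<sigma>) \<in> pt ` {\<rho><..<\<sigma>}"
proof -
  \<comment> \<open>The third point: the middle of the arc complementary to the one from
    \<open>\<rho>\<close> to \<open>\<sigma>\<close>.\<close>
  define \<alpha> where "\<alpha> = (\<rho> + \<sigma> - pi) / 2"
  have a: "\<sigma> - pi < \<alpha>" "\<alpha> < \<rho>" using rs by (auto simp: \<alpha>_def)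
  define g where "g \<beta> = B (pt \<alpha>) (pt \<beta>)" for \<beta>
  have g: "continuous_map euclideanreal proj_topology g"
    unfolding g_def by (intro continuous_map_B) (auto simp: U continuous_map_pt)
  \<comment> \<open>\<open>S1\<close> and \<open>S2\<close> collect the end points
    \<open>\<beta>\<close> for which the arc of \<open>pt \<alpha>\<close> and
    \<open>pt \<beta>\<close> lies on one side or the other. An angle \<open>m\<close> separating
    \<open>\<beta>\<close> from the angle of \<open>g \<beta>\<close> turns each condition into a
    union of open ones.\<close>
  define S1 where "S1 = (\<Union>m\<in>{\<alpha><..<\<alpha> + pi}. {m<..<\<alpha> + pi} \<inter> {\<beta>. g \<beta> \<in> pt ` {\<alpha><..<m}})"
  define S2 where "S2 = (\<Union>m\<in>{\<alpha><..<\<alpha> + pi}. {\<alpha><..<m} \<inter> {\<beta>. g \<beta> \<in> pt ` {m<..<\<alpha> + pi}})"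
  have pre: "open {\<beta>. g \<beta> \<in> pt ` {x<..<y}}" for x y
    using openin_continuous_map_preimage[OF g openin_pt_image[of "{x<..<y}"]] by simp
  have op: "open S1" "open S2" unfolding S1_def S2_def by (auto intro!: open_UN open_Int pre)
  have S1: "g \<beta> \<in> pt ` {\<alpha><..<\<beta>}" "\<beta> \<in> {\<alpha><..<\<alpha> + pi}" if "\<beta> \<in> S1" for \<beta>
    using that unfolding S1_def by auto
  have S2: "g \<beta> \<in> pt ` {\<beta><..<\<alpha> + pi}" "\<beta> \<in> {\<alpha><..<\<alpha> + pi}" if "\<beta> \<in> S2" for \<beta>
    using that unfolding S2_def by auto
  have gne: "g \<beta> \<in> proj_line - {pt \<alpha>, pt \<beta>}" if "\<beta> \<in> {\<alpha><..<\<alpha> + pi}" for \<beta>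
  proof -
    have "pt \<alpha> \<noteq> pt \<beta>" using pt_inj[of \<alpha> \<beta>] that by auto
    then show ?thesis using H4[of "pt \<alpha>" "pt \<beta>"] B_in_proj_line[of "pt \<alpha>" "pt \<beta>"] by (auto simp: U g_def)
  qed
  have "{\<alpha><..<\<alpha> + pi} \<subseteq> S1 \<union> S2"
  proof
    fix \<beta> assume b: "\<beta> \<in> {\<alpha><..<\<alpha> + pi}"
    then consider x where "x \<in> {\<alpha><..<\<beta>}" "g \<beta> = pt x" | x where "x \<in> {\<beta><..<\<alpha> + pi}" "g \<beta> = pt x"
      using gne[OF b] proj_line_Diff_pair(1)[of \<alpha> \<beta>] by auto
    then show "\<beta> \<in> S1 \<union> S2"
    proof cases
      case 1
      then have "\<beta> \<in> S1" unfolding S1_def using b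
        by (intro UN_I[of "(x + \<beta>) / 2"]) auto
      then show ?thesis by simp
    next
      case 2
      then have "\<beta> \<in> S2" unfolding S2_def using b
        by (intro UN_I[of "(x + \<beta>) / 2"]) auto
      then show ?thesis by simp
    qed
  qed
  moreover have "S1 \<inter> S2 \<inter> {\<alpha><..<\<alpha> + pi} = {}"
  proof -
    have False if "\<beta> \<in> S1" "\<beta> \<in> S2" for \<beta>
    proof -
      have "\<alpha> < \<beta>" "\<beta> < \<alpha> + pi" using S1(2)[OF that(1)] by auto
      from proj_line_Diff_pair(2)[OF this] show False using S1(1)[OF that(1)] S2(1)[OF that(2)] by blast
    qed
    then show ?thesis by blast
  qed
  ultimately have split: "S1 \<inter> {\<alpha><..<\<alpha> + pi} = {} \<or> S2 \<inter> {\<alpha><..<\<alpha> + pi} = {}"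
    using connectedD[OF connected_Ioo[of \<alpha> "\<alpha> + pi"] op] by blast
  have ne: "pt \<rho> \<noteq> pt \<sigma>" using pt_inj[of \<rho> \<sigma>] rs by auto
  have Brs: "B (pt \<rho>) (pt \<sigma>) \<in> proj_line" "B (pt \<rho>) (pt \<sigma>) \<noteq> pt \<rho>" "B (pt \<rho>) (pt \<sigma>) \<noteq> pt \<sigma>"
    using H4[of "pt \<rho>" "pt \<sigma>"] B_in_proj_line[of "pt \<rho>" "pt \<sigma>"] ne by (auto simp: U)
  from rs refl Brs show ?thesis
  proof (cases rule: arc_of_cases)
    case 1
    then show ?thesis by simp
  next
    case 2
    from split show ?thesis
    proof
      assume 0: "S2 \<inter> {\<alpha><..<\<alpha> + pi} = {}"
      \<comment> \<open>With \<open>\<beta>\<close> beyond \<open>\<sigma>\<close>, both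
        \<open>\<rho>\<close> and \<open>\<sigma>\<close> are interior to the arc from
        \<open>\<alpha>\<close> to \<open>\<beta>\<close>. By (H5) it would contain the arc from
        \<open>\<sigma>\<close> to \<open>\<rho> + pi\<close>, which however passes through the gap
        between \<open>\<beta>\<close> and \<open>\<alpha> + pi\<close>.\<close>
      define \<beta> where "\<beta> = (\<sigma> + \<alpha> + pi) / 2"
      have b: "\<sigma> < \<beta>" "\<beta> < \<alpha> + pi" using a by (auto simp: \<beta>_def)
      then have "\<beta> \<in> {\<alpha><..<\<alpha> + pi}" using a rs by auto
      then have "\<beta> \<in> S1" using 0 \<open>{\<alpha><..<\<alpha> + pi} \<subseteq> S1 \<union> S2\<close> by blast
      then have arc: "arc_of B (pt \<alpha>) (pt \<beta>) = pt ` {\<alpha>..\<beta>}"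
        using S1[of \<beta>] by (intro arc_of_eq) (auto simp: g_def)
      have "pt \<alpha> \<noteq> pt \<beta>" using pt_inj[of \<alpha> \<beta>] a b rs by auto
      then have "pt ` {\<sigma>..\<rho> + pi} \<subseteq> pt ` {\<alpha>..\<beta>}"
        using H5[of "pt \<alpha>" "pt \<beta>" "pt \<rho>" "pt \<sigma>"] ne a b rs unfolding arc 2
        by (auto simp: interior_of_arc U)
      moreover have "pt ((\<beta> + \<alpha> + pi) / 2) \<in> pt ` {\<sigma>..\<rho> + pi}" using a b by (intro imageI) auto
      moreover have "pt ((\<beta> + \<alpha> + pi) / 2) \<in> pt ` {\<beta><..<\<alpha> + pi}" using a b by (intro imageI) auto
      moreover have "proj_line - pt ` {\<alpha>..\<beta>} = pt ` {\<beta><..<\<alpha> + pi}"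
        using a b rs by (intro proj_line_Diff_arc) auto
      ultimately show ?thesis by blast
    next
      assume 0: "S1 \<inter> {\<alpha><..<\<alpha> + pi} = {}"
      \<comment> \<open>The mirror image: \<open>\<beta>\<close> precedes \<open>\<rho>\<close>, and
        the gap lies between \<open>\<alpha> + pi\<close> and \<open>\<beta> + pi\<close>.\<close>
      define \<beta> where "\<beta> = (\<alpha> + \<rho>) / 2"
      have b: "\<alpha> < \<beta>" "\<beta> < \<rho>" using a by (auto simp: \<beta>_def)
      then have "\<beta> \<in> {\<alpha><..<\<alpha> + pi}" using a rs by auto
      then have "\<beta> \<in> S2" using 0 \<open>{\<alpha><..<\<alpha> + pi} \<subseteq> S1 \<union> S2\<close> by blast
      then have arc: "arc_of B (pt \<alpha>) (pt \<beta>) = pt ` {\<beta>..\<alpha> + pi}"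
        using S2[of \<beta>] by (intro arc_of_eq) (auto simp: g_def)
      have "pt \<alpha> \<noteq> pt \<beta>" using pt_inj[of \<alpha> \<beta>] a b rs by auto
      then have "pt ` {\<sigma>..\<rho> + pi} \<subseteq> pt ` {\<beta>..\<alpha> + pi}"
        using H5[of "pt \<alpha>" "pt \<beta>" "pt \<rho>" "pt \<sigma>"] ne a b rs unfolding arc 2
        by (auto simp: interior_of_arc U)
      moreover have "\<exists>m. \<alpha> < m \<and> m < \<beta>" using b(1) by (rule dense)
      then obtain m where m: "\<alpha> < m" "m < \<beta>" by blast
      have "pt (m + pi) \<in> pt ` {\<sigma>..\<rho> + pi}" using a b m by (intro imageI) auto
      moreover have "pt (m + pi) \<in> pt ` {\<alpha> + pi<..<\<beta> + pi}" using m by (intro imageI) auto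
      moreover have "proj_line - pt ` {\<beta>..\<alpha> + pi} = pt ` {\<alpha> + pi<..<\<beta> + pi}"
        using a b rs by (intro proj_line_Diff_arc) auto
      ultimately show ?thesis by blast
    qed
  qed
qed

text \<open>The angles 0, \<open>pi / 2\<close> and the angles \<open>pi / 2\<close>,
  \<open>pi\<close> list the same two points, so \<open>arc_of_proj_line\<close> would put their
  image under \<open>B\<close> into two disjoint arcs.\<close>

lemma U_ne_proj_line: "U \<noteq> proj_line"
proof
  assume U: "U = proj_line"
  have "B (pt 0) (pt (pi / 2)) \<in> pt ` {0<..<pi / 2}"
    by (rule arc_of_proj_line[OF U]) auto
  moreover have "B (pt (pi / 2)) (pt pi) \<in> pt ` {pi / 2<..<pi}"
    by (rule arc_of_proj_line[OF U]) auto
  moreover have "B (pt (pi / 2)) (pt pi) = B (pt 0) (pt (pi / 2))"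
    using pt_add_pi[of 0] B_sym[of "pt 0" "pt (pi / 2)"] by (simp add: U)
  ultimately show False using proj_line_Diff_pair(2)[of 0 "pi / 2"] by auto
qed

end

text \<open>A basis whose second vector spans a point outside \<open>U\<close>, which thereby becomes the point at infinity
  of the affine coordinate.\<close>

locale chord_map_affine = chord_map +
  assumes infinity: "pt (pi / 2) \<notin> U"
begin

definition I :: "real set" where
  "I = {t. aff t \<in> U}"

lemma aff_in_U_iff: "aff t \<in> U \<longleftrightarrow> t \<in> I"
  by (simp add: I_def)

lemma open_I: "open I"
  using openin_continuous_map_preimage[OF continuous_map_aff openin_U] by (simp add: I_def)

lemma U_cases:
  assumes "p \<in> U"
  obtains t where "p = aff t" "t \<in> I"
proof -
  have "p \<in> proj_line" using assms U_subset by blast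
  then obtain \<theta> where \<theta>: "- (pi / 2) \<le> \<theta>" "\<theta> < - (pi / 2) + pi" "p = pt \<theta>" by (rule pt_cases)
  have "\<theta> \<noteq> - (pi / 2)"
    using infinity assms \<theta>(3) pt_add_pi[of "- (pi / 2)"] by auto
  then have "p = aff (tan \<theta>)" using \<theta> pt_eq_aff[of \<theta>] by auto
  then show thesis using that assms by (auto simp: I_def)
qed

text \<open>One of the two arcs between the points passes through infinity, which is not in
  \<open>U\<close>; the selected arc is contained in \<open>U\<close>, so it is the other
  one.\<close>

lemma arc_aff:
  assumes "s \<in> I" "t \<in> I" "s < t"
  shows "B (aff s) (aff t) \<in> aff ` {s<..<t}" "aff ` {s..t} \<subseteq> U"
proof -
  define \<alpha> \<beta> where "\<alpha> = arctan s" and "\<beta> = arctan t"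
  have ab: "\<alpha> < \<beta>" "\<beta> < \<alpha> + pi" "- (pi / 2) < \<alpha>" "\<beta> < pi / 2"
    using assms arctan_bounded[of s] arctan_bounded[of t] by (auto simp: \<alpha>_def \<beta>_def arctan_less_iff)
  have U: "aff s \<in> U" "aff t \<in> U" "aff s \<noteq> aff t" using assms by (auto simp: I_def)
  have B: "B (aff s) (aff t) \<in> proj_line" "B (aff s) (aff t) \<noteq> aff s" "B (aff s) (aff t) \<noteq> aff t"
    using H4[of "aff s" "aff t"] B_in_proj_line U by auto
  have eq: "{aff s, aff t} = {pt \<alpha>, pt \<beta>}" by (simp add: aff_eq_pt \<alpha>_def \<beta>_def)
  have "B (aff s) (aff t) \<in> aff ` {s<..<t} \<and> aff ` {s..t} \<subseteq> U"
    using ab(1,2) eq B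
  proof (cases rule: arc_of_cases)
    case 1
    then obtain \<theta> where \<theta>: "\<alpha> < \<theta>" "\<theta> < \<beta>" "B (aff s) (aff t) = pt \<theta>" by auto
    have "s < tan \<theta>" "tan \<theta> < t"
      using tan_monotone[of \<alpha> \<theta>] tan_monotone[of \<theta> \<beta>] \<theta> ab by (auto simp: \<alpha>_def \<beta>_def tan_arctan)
    moreover have "B (aff s) (aff t) = aff (tan \<theta>)" using \<theta> ab pt_eq_aff[of \<theta>] by simp
    moreover have "aff ` {s..t} \<subseteq> arc_of B (aff s) (aff t)"
      unfolding 1 by (auto simp: aff_eq_pt \<alpha>_def \<beta>_def arctan_le_iff)
    ultimately show ?thesis using arc_subset_U[OF U] by auto
  next
    case 2
    have "pt (pi / 2) \<in> pt ` {\<beta>..\<alpha> + pi}" using ab by (intro imageI) auto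
    then show ?thesis using arc_subset_U[OF U] 2 infinity by auto
  qed
  then show "B (aff s) (aff t) \<in> aff ` {s<..<t}" "aff ` {s..t} \<subseteq> U" by auto
qed

text \<open>As \<open>t\<close> decreases to \<open>s\<close>, the point \<open>B q (aff t)\<close>
  is squeezed between \<open>q\<close> and \<open>aff t\<close>; by continuity and the Hausdorff
  property only \<open>q\<close> is left as the value at \<open>q\<close>.\<close>

lemma B_diag:
  assumes "q \<in> U"
  shows "B q q = q"
proof (rule ccontr)
  assume ne: "B q q \<noteq> q"
  obtain s where s: "q = aff s" "s \<in> I" using assms by (rule U_cases)
  have "B q q \<in> proj_line" using B_in_proj_line assms by simp
  then obtain V W where VW: "openin proj_topology V" "openin proj_topology W"
    "q \<in> V" "B q q \<in> W" "disjnt V W"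
    using Hausdorff_proj ne unfolding Hausdorff_space_def by (metis assms subsetD U_subset topspace_proj)
  have "continuous_map (top_of_set I) proj_topology (\<lambda>t. B q (aff t))"
    by (intro continuous_map_B continuous_map_from_subtopology continuous_map_aff)
      (auto simp: assms I_def in_mono[OF U_subset])
  from openin_continuous_map_preimage[OF this VW(2)]
  have "open {t \<in> I. B q (aff t) \<in> W}"
    using open_I by (simp add: openin_open_eq)
  moreover have "open {t. aff t \<in> V}"
    using openin_continuous_map_preimage[OF continuous_map_aff VW(1)] by simp
  ultimately have "open ({t \<in> I. B q (aff t) \<in> W} \<inter> {t. aff t \<in> V})" by blast
  moreover have "s \<in> {t \<in> I. B q (aff t) \<in> W} \<inter> {t. aff t \<in> V}" using s VW by auto
  ultimately obtain e where e: "e > 0" "cball s e \<subseteq> {t \<in> I. B q (aff t) \<in> W} \<inter> {t. aff t \<in> V}"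
    using open_contains_cball by blast
  have "s + e \<in> cball s e" using e by (simp add: dist_real_def)
  then have "s + e \<in> I" and W: "B q (aff (s + e)) \<in> W" using e(2) by auto
  then obtain x where x: "s < x" "x < s + e" "B q (aff (s + e)) = aff x"
    using arc_aff(1)[of s "s + e"] s e(1) by auto
  then have "x \<in> cball s e" by (simp add: dist_real_def)
  then have "aff x \<in> V" using e(2) by auto
  then show False using VW(5) W x(3) by (auto simp: disjnt_iff)
qed

section \<open>The chord slopes in the affine coordinate\<close>

definition b :: "real \<Rightarrow> real \<Rightarrow> real" where
  "b s t = (SOME x. aff x = B (aff s) (aff t))"

lemma aff_b_between: "s \<in> I \<Longrightarrow> t \<in> I \<Longrightarrow> s < t \<Longrightarrow> B (aff s) (aff t) = aff (b s t) \<and> s < b s t \<and> b s t < t"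
proof -
  assume "s \<in> I" "t \<in> I" "s < t"
  then obtain x where x: "s < x" "x < t" "B (aff s) (aff t) = aff x" using arc_aff(1)[of s t] by auto
  then have "b s t = x" unfolding b_def by (intro some_equality) auto
  with x show ?thesis by simp
qed

lemma b_diag: "s \<in> I \<Longrightarrow> b s s = s"
  unfolding b_def by (rule some_equality) (auto simp: B_diag aff_in_U_iff)

lemma b_sym: "s \<in> I \<Longrightarrow> t \<in> I \<Longrightarrow> b s t = b t s"
  unfolding b_def using B_sym[of "aff s" "aff t"] by (simp add: aff_in_U_iff)

lemma B_aff:
  assumes "s \<in> I" "t \<in> I"
  shows "B (aff s) (aff t) = aff (b s t)"
proof (cases s t rule: linorder_cases)
  case less
  then show ?thesis using aff_b_between assms by blast
next
  case equal
  then show ?thesis using assms by (simp add: b_diag B_diag aff_in_U_iff)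
next
  case greater
  have "B (aff s) (aff t) = B (aff t) (aff s)" using B_sym assms by (simp add: aff_in_U_iff)
  also have "\<dots> = aff (b t s)" using aff_b_between assms greater by blast
  finally show ?thesis using b_sym[OF assms] by simp
qed

lemma cr_cases_aff:
  assumes "x \<noteq> z" "y \<noteq> w" "x \<noteq> w" "y \<noteq> z"
  shows "(aff x, aff y, aff z, aff w) \<in> cr_case (Some 0) \<inter> cr_case None"
    and "cross_ratio (aff x, aff y, aff z, aff w) = Some ((z - x) * (w - y) / ((w - x) * (z - y)))"
proof -
  have d: "(aff x, aff y, aff z, proj_pt (vec 1 w)) \<in> cr_dom"
    using assms unfolding aff_def[symmetric] cr_dom_def by auto
  have "vec 1 w \<noteq> 0" by simp
  from cross_ratio_aff[OF this d] show c: "cross_ratio (aff x, aff y, aff z, aff w) =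
      Some ((z - x) * (w - y) / ((w - x) * (z - y)))"
    using assms by (simp add: aff_def)
  show "(aff x, aff y, aff z, aff w) \<in> cr_case (Some 0) \<inter> cr_case None"
    using d assms unfolding cr_case_def aff_def[symmetric] by (simp add: c)
qed

sublocale chord_slopes I b
proof
  show "open I" by (rule open_I)
  show "z \<in> I" if "x \<in> I" "y \<in> I" "x \<le> z" "z \<le> y" for x y z
    using arc_aff(2)[of x y] that by (cases "x = y") (auto simp: aff_in_U_iff image_subset_iff)
  show "b x y = b y x" if "x \<in> I" "y \<in> I" for x y using that by (rule b_sym)
  show "b x x = x" if "x \<in> I" for x using that by (rule b_diag)
  show "x < b x y \<and> b x y < y" if "x \<in> I" "y \<in> I" "x < y" for x y
    using aff_b_between that by blast
  show "continuous_on (I \<times> I) (\<lambda>z. b (fst z) (snd z))"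
    unfolding continuous_openin_preimage_eq
  proof (intro allI impI)
    fix T :: "real set" assume T: "open T"
    have "continuous_map (top_of_set (I \<times> I)) proj_topology (\<lambda>z. B (aff (fst z)) (aff (snd z)))"
    proof (rule continuous_map_B)
      have "continuous_map (top_of_set (I \<times> I)) euclideanreal fst"
        "continuous_map (top_of_set (I \<times> I)) euclideanreal snd"
        by (auto intro!: continuous_intros)
      from this[THEN continuous_map_compose, OF continuous_map_aff]
      show "continuous_map (top_of_set (I \<times> I)) proj_topology (\<lambda>z. aff (fst z))"
        "continuous_map (top_of_set (I \<times> I)) proj_topology (\<lambda>z. aff (snd z))"
        by (simp_all add: o_def)
    qed (auto simp: aff_in_U_iff)
    from openin_continuous_map_preimage[OF this openin_aff_image[OF T]]
    have "openin (top_of_set (I \<times> I)) {z \<in> I \<times> I. B (aff (fst z)) (aff (snd z)) \<in> aff ` T}" by simp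
    also have "{z \<in> I \<times> I. B (aff (fst z)) (aff (snd z)) \<in> aff ` T} = I \<times> I \<inter> (\<lambda>z. b (fst z) (snd z)) -` T"
      by (auto simp: B_aff)
    finally show "openin (top_of_set (I \<times> I)) (I \<times> I \<inter> (\<lambda>z. b (fst z) (snd z)) -` T)" .
  qed
  fix p q r s
  assume I: "p \<in> I" "q \<in> I" "r \<in> I" "s \<in> I"
    and ne: "b p q \<noteq> b p s" "b p q \<noteq> b r s" "b p r \<noteq> b p s" "b p r \<noteq> b r s"
    "b p q \<noteq> b q s" "b q r \<noteq> b q s" "b q r \<noteq> b r s"
  note l = cr_cases_aff[of "b p q" "b p s" "b p r" "b r s", OF ne(1,4,2,3)]
  note r = cr_cases_aff[of "b p q" "b q s" "b q r" "b r s", OF ne(5,7,2,6)]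
  have "cross_ratio (aff (b p q), aff (b p r), aff (b p s), aff (b r s)) =
      cross_ratio (aff (b p q), aff (b q r), aff (b q s), aff (b r s))"
    using H6[of "aff p" "aff q" "aff r" "aff s"] I l(1) r(1) by (simp add: B_aff aff_in_U_iff)
  then have e: "(b p s - b p q) * (b r s - b p r) / ((b r s - b p q) * (b p s - b p r)) =
      (b q s - b p q) * (b r s - b q r) / ((b r s - b p q) * (b q s - b q r))"
    by (simp add: l(2) r(2))
  \<comment> \<open>The factor common to the denominators of the two cross-ratios; cancelling it
    leaves the cubic identity.\<close>
  define x where "x = b r s - b p q"
  have nz: "x \<noteq> 0" "b p s - b p r \<noteq> 0" "b q s - b q r \<noteq> 0" using ne by (auto simp: x_def)
  from e have "((b p s - b p q) * (b r s - b p r) * (b q s - b q r)) * x =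
      ((b q s - b p q) * (b r s - b q r) * (b p s - b p r)) * x"
    unfolding x_def[symmetric] using nz by (subst (asm) frac_eq_eq) (auto simp: algebra_simps)
  then have "(b p s - b p q) * (b r s - b p r) * (b q s - b q r) =
      (b q s - b p q) * (b r s - b q r) * (b p s - b p r)" using nz by simp
  then show "(b p q - b p s) * (b p r - b r s) * (b q r - b q s) =
        (b p q - b q s) * (b q r - b r s) * (b p r - b p s)" by algebra
qed

section \<open>The conclusions about \<open>B\<close> and the cross-ratios, for \<open>U\<close> in
  the affine chart\<close>

lemma inj_on_B:
  assumes "p \<in> U"
  shows "inj_on (B p) U"
proof (rule inj_onI)
  obtain s where p: "p = aff s" "s \<in> I" using assms by (rule U_cases)
  fix x y assume "x \<in> U" "y \<in> U" "B p x = B p y"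
  moreover obtain s' where "x = aff s'" "s' \<in> I" using \<open>x \<in> U\<close> by (rule U_cases)
  moreover obtain t where "y = aff t" "t \<in> I" using \<open>y \<in> U\<close> by (rule U_cases)
  ultimately show "x = y" using p by (simp add: B_aff b_eq_iff)
qed

lemma B_image: "p \<in> U \<Longrightarrow> B p ` U \<subseteq> U"
  by (auto elim!: U_cases simp: B_aff aff_in_U_iff b_in_I)

text \<open>Strict monotonicity multiplies each difference of coordinates by a positive factor, so
  the sign of the triple product is kept; the basis in which the order is read enters only by
  \<open>\<delta>\<close>, the same before and after.\<close>

lemma orientation_B:
  assumes "p \<in> U"
  shows "orientation_preserving_on U (B p)"
  unfolding orientation_preserving_on_def
proof (intro allI impI ballI)
  obtain s where p: "p = aff s" "s \<in> I" using assms by (rule U_cases)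
  fix u v x y z
  assume uv: "lin_indep2 u v" and xyz: "x \<in> U" "y \<in> U" "z \<in> U" and pos: "pos_cyclic u v x y z"
  obtain x' where x: "x = aff x'" "x' \<in> I" using xyz(1) by (rule U_cases)
  obtain y' where y: "y = aff y'" "y' \<in> I" using xyz(2) by (rule U_cases)
  obtain z' where z: "z = aff z'" "z' \<in> I" using xyz(3) by (rule U_cases)
  obtain \<delta> where \<delta>: "\<And>r s t. pos_cyclic u v (aff r) (aff s) (aff t) \<longleftrightarrow> \<delta> * ((s - r) * (t - s) * (r - t)) < 0"
    by (rule pos_cyclic_aff_iff[OF uv]) blast
  have scale: "\<exists>\<kappa>>0. b s m - b s n = \<kappa> * (m - n)" if "m \<in> I" "n \<in> I" for m n
  proof (cases "m = n")
    case False
    then show ?thesis using that p b_strict_mono[of s m n] b_strict_mono[of s n m]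
      by (intro exI[of _ "(b s m - b s n) / (m - n)"]) (cases m n rule: linorder_cases; auto simp: divide_neg_neg)
  qed (auto intro: exI[of _ 1])
  obtain k l m where klm: "k > 0" "l > 0" "m > 0" "b s y' - b s x' = k * (y' - x')"
    "b s z' - b s y' = l * (z' - y')" "b s x' - b s z' = m * (x' - z')"
    using scale x y z by meson
  have "\<delta> * ((b s y' - b s x') * (b s z' - b s y') * (b s x' - b s z')) =
    (k * l * m) * (\<delta> * ((y' - x') * (z' - y') * (x' - z')))"
    unfolding klm by (simp add: algebra_simps)
  moreover have "\<delta> * ((y' - x') * (z' - y') * (x' - z')) < 0" using pos unfolding x y z \<delta> .
  ultimately have "\<delta> * ((b s y' - b s x') * (b s z' - b s y') * (b s x' - b s z')) < 0"
    using klm(1-3) by (metis mult_pos_neg mult_pos_pos)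
  then show "pos_cyclic u v (B p x) (B p y) (B p z)"
    using p x y z by (simp add: B_aff \<delta>)
qed

text \<open>By injectivity, coincidences among the three slopes are coincidences among
  \<open>x\<close>, \<open>y\<close>, \<open>z\<close>. A finite value then means that both factors
  of the denominator survive, a nonzero one that both factors of the numerator do; either condition
  already places the quadruple in \<open>cr_dom\<close>.\<close>

lemma r_quad_aff:
  assumes I: "x \<in> I" "y \<in> I" "z \<in> I" and q: "vec k c \<noteq> 0"
  shows "r_quad B (proj_pt (vec k c)) (aff x) (aff y) (aff z) \<in> cr_case None \<longleftrightarrow>
      x \<noteq> z \<and> c - k * b x z \<noteq> 0"
    and "r_quad B (proj_pt (vec k c)) (aff x) (aff y) (aff z) \<in> cr_case (Some 0) \<longleftrightarrow>
      y \<noteq> z \<and> c - k * b y z \<noteq> 0"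
    and "r_quad B (proj_pt (vec k c)) (aff x) (aff y) (aff z) \<in> cr_case None \<Longrightarrow>
      r_val B (proj_pt (vec k c)) (aff x) (aff y) (aff z) =
      Some (rho x y z * ((c - k * b y z) / (c - k * b x z)))"
proof -
  let ?Q = "r_quad B (proj_pt (vec k c)) (aff x) (aff y) (aff z)"
  have Q: "?Q = (aff (b x z), aff (b y z), aff (b x y), proj_pt (vec k c))"
    using I by (simp add: r_quad_def B_aff)
  have eqs: "b x z = b y z \<longleftrightarrow> x = y" "b x z = b x y \<longleftrightarrow> y = z" "b y z = b x y \<longleftrightarrow> x = z"
    using I b_eq_iff b_eq_iff' sym by metis+
  have qp: "proj_pt (vec k c) \<in> proj_line" using q by (rule proj_pt_in_proj_line)
  have dom: "?Q \<in> cr_dom \<longleftrightarrow> \<not> (x = y \<and> x = z) \<and> \<not> (x = y \<and> c - k * b y z = 0) \<and>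
      \<not> (y = z \<and> c - k * b x y = 0) \<and> \<not> (x = z \<and> c - k * b x y = 0)"
    unfolding Q cr_dom_def using qp
    by (auto simp only: mem_Collect_eq prod.case aff_eq_iff aff_eq_proj_pt_iff[OF q] eqs) auto
  have val: "cross_ratio ?Q = (if (c - k * b x z) * (b x y - b y z) = 0 then None
      else Some ((b x y - b x z) * (c - k * b y z) / ((c - k * b x z) * (b x y - b y z))))"
    if "?Q \<in> cr_dom"
    using cross_ratio_aff[OF q] that unfolding Q by blast
  show 1: "?Q \<in> cr_case None \<longleftrightarrow> x \<noteq> z \<and> c - k * b x z \<noteq> 0"
  proof
    assume Qc: "?Q \<in> cr_case None"
    then have "?Q \<in> cr_dom" "cross_ratio ?Q \<noteq> None" by (auto simp: cr_case_def)
    then show "x \<noteq> z \<and> c - k * b x z \<noteq> 0" using val I eqs by (auto split: if_splits)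
  next
    assume h: "x \<noteq> z \<and> c - k * b x z \<noteq> 0"
    then have d: "?Q \<in> cr_dom" unfolding dom by auto
    then show "?Q \<in> cr_case None" using val[OF d] h eqs(3) by (auto simp: cr_case_def)
  qed
  show "?Q \<in> cr_case (Some 0) \<longleftrightarrow> y \<noteq> z \<and> c - k * b y z \<noteq> 0"
  proof
    assume Qc: "?Q \<in> cr_case (Some 0)"
    then have d: "?Q \<in> cr_dom" "cross_ratio ?Q \<noteq> Some 0" by (auto simp: cr_case_def)
    show "y \<noteq> z \<and> c - k * b y z \<noteq> 0"
    proof (rule ccontr)
      assume h: "\<not> (y \<noteq> z \<and> c - k * b y z \<noteq> 0)"
      then have "(b x y - b x z) * (c - k * b y z) = 0" by auto
      \<comment> \<open>Inside \<open>cr_dom\<close> numerator and denominator do not vanish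
        together, so a vanishing numerator would give the value 0 rather than infinity.\<close>
      moreover have "(c - k * b x z) * (b x y - b y z) \<noteq> 0"
      proof -
        have "x \<noteq> z" using d(1) h unfolding dom by (auto simp: sym I)
        moreover have "c - k * b x z \<noteq> 0"
        proof
          assume "c - k * b x z = 0"
          show False
          proof (cases "y = z")
            case True
            then show False using d(1) \<open>c - k * b x z = 0\<close> unfolding dom by auto
          next
            case False
            then have 0: "c - k * b y z = 0" using h by auto
            then have "k * (b x z - b y z) = 0" using \<open>c - k * b x z = 0\<close> unfolding right_diff_distrib by linarith
            then have "k = 0 \<or> x = y" using eqs(1) by auto
            then show False using 0 d(1) q unfolding dom by auto
          qed
        qed
        ultimately show ?thesis using eqs(3) by auto
      qed
      ultimately show False using val[OF d(1)] d(2) by simp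
    qed
  next
    assume h: "y \<noteq> z \<and> c - k * b y z \<noteq> 0"
    then have d: "?Q \<in> cr_dom" unfolding dom using sym I by auto
    then show "?Q \<in> cr_case (Some 0)" using val[OF d] h eqs(2) by (auto simp: cr_case_def)
  qed
  assume Qc: "?Q \<in> cr_case None"
  then have d: "?Q \<in> cr_dom" and h: "x \<noteq> z \<and> c - k * b x z \<noteq> 0" using 1 by (auto simp: cr_case_def)
  have "rho x y z * ((c - k * b y z) / (c - k * b x z)) =
      (b x y - b x z) * (c - k * b y z) / ((c - k * b x z) * (b x y - b y z))"
  proof -
    have "rho x y z = (b x y - b x z) / (b x y - b y z)"
      unfolding rho_def by (metis minus_diff_eq minus_divide_divide)
    then show ?thesis by (simp add: mult.commute)
  qed
  then show "r_val B (proj_pt (vec k c)) (aff x) (aff y) (aff z) =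
      Some (rho x y z * ((c - k * b y z) / (c - k * b x z)))"
    using val[OF d] h eqs(3) by (simp add: r_val_def)
qed

text \<open>The two terms have the same first and last argument, hence the same denominator, and
  \<open>kappa_slope\<close> combines their numerators.\<close>

lemma d_defined_aff:
  assumes I: "x \<in> I" "y \<in> I" "u \<in> I" "v \<in> I" and q: "vec k c \<noteq> 0" and uv: "u \<noteq> v" "c - k * b u v \<noteq> 0"
  shows "d_defined B (proj_pt (vec k c)) (aff x) (aff y) (aff u) (aff v)"
    and "d_val B (proj_pt (vec k c)) (aff x) (aff y) (aff u) (aff v) =
      kappa x y u v * ((c - k * b x y) / (c - k * b u v))"
proof -
  have x: "r_quad B (proj_pt (vec k c)) (aff u) (aff x) (aff v) \<in> cr_case None"
    and y: "r_quad B (proj_pt (vec k c)) (aff u) (aff y) (aff v) \<in> cr_case None"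
    using r_quad_aff(1)[of u _ v k c] I q uv by auto
  then show "d_defined B (proj_pt (vec k c)) (aff x) (aff y) (aff u) (aff v)"
    by (simp add: d_defined_def)
  have "d_val B (proj_pt (vec k c)) (aff x) (aff y) (aff u) (aff v) =
      rho u x v * ((c - k * b x v) / (c - k * b u v)) - rho u y v * ((c - k * b y v) / (c - k * b u v))"
    unfolding d_val_def using r_quad_aff(3)[OF _ _ _ q x] r_quad_aff(3)[OF _ _ _ q y] I by simp
  also have "\<dots> = (rho u x v * (c - k * b x v) - rho u y v * (c - k * b y v)) / (c - k * b u v)"
    by (simp only: times_divide_eq_right diff_divide_distrib[symmetric])
  also have "\<dots> = kappa x y u v * ((c - k * b x y) / (c - k * b u v))"
    using kappa_slope[OF I uv(1), of c k] by simp
  finally show "d_val B (proj_pt (vec k c)) (aff x) (aff y) (aff u) (aff v) =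
      kappa x y u v * ((c - k * b x y) / (c - k * b u v))" .
qed

text \<open>When all values are finite, the linear form at the slope of \<open>y\<close> and
  \<open>t\<close> cancels between the two factors, and \<open>rho_mult\<close> does the
  rest.\<close>

lemma multiplicative_r:
  assumes U: "x \<in> U" "y \<in> U" "z \<in> U" "t \<in> U" and q: "q \<in> proj_line" and i: "i \<in> {None, Some 0}"
    and c: "r_quad B q x y t \<in> cr_case i" "r_quad B q y z t \<in> cr_case i"
  shows "r_quad B q x z t \<in> cr_case i \<and> rinf_mult (r_val B q x y t) (r_val B q y z t) = r_val B q x z t"
proof -
  obtain x' where x: "x = aff x'" "x' \<in> I" using U(1) by (rule U_cases)
  obtain y' where y: "y = aff y'" "y' \<in> I" using U(2) by (rule U_cases)
  obtain z' where z: "z = aff z'" "z' \<in> I" using U(3) by (rule U_cases)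
  obtain t' where t: "t = aff t'" "t' \<in> I" using U(4) by (rule U_cases)
  obtain k m where q: "vec k m \<noteq> 0" "q = proj_pt (vec k m)" using proj_line_vec[OF q] by blast
  note R = r_quad_aff[OF _ _ _ q(1), folded q(2)]
  have fin: "rinf_mult (r_val B q x y t) (r_val B q y z t) = r_val B q x z t"
    if h: "x' \<noteq> t'" "m - k * b x' t' \<noteq> 0" "y' \<noteq> t'" "m - k * b y' t' \<noteq> 0"
  proof -
    have n: "r_quad B q x y t \<in> cr_case None" "r_quad B q y z t \<in> cr_case None" "r_quad B q x z t \<in> cr_case None"
      using R(1) h x y z t by auto
    have "rinf_mult (r_val B q x y t) (r_val B q y z t) =
        Some ((rho x' y' t' * rho y' z' t') * ((m - k * b z' t') / (m - k * b x' t')))"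
      using R(3) n x y z t h by simp
    also have "\<dots> = r_val B q x z t"
      using R(3) n x y z t h rho_mult[of x' y' z' t'] by simp
    finally show ?thesis .
  qed
  from i show ?thesis
  proof (elim insertE emptyE)
    assume i: "i = None"
    then show ?thesis using c R(1) x y z t fin by auto
  next
    assume i: "i = Some 0"
    have h: "y' \<noteq> t'" "m - k * b y' t' \<noteq> 0" "z' \<noteq> t'" "m - k * b z' t' \<noteq> 0"
      using c i R(2) x y z t by auto
    have xz: "r_quad B q x z t \<in> cr_case i" using h R(2) x z t i by auto
    show ?thesis
    proof (cases "r_quad B q x z t \<in> cr_case None")
      case True
      then show ?thesis using xz fin h R(1) x y z t by auto
    next
      case False
      \<comment> \<open>Finiteness depends only on the first and last argument, here
        \<open>x\<close> and \<open>t\<close> for both terms. So both are infinite, and since the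
        other factor is in the case \<open>C_0\<close>, the product 0 times infinity does not
        arise.\<close>
      then have F: "r_quad B q x y t \<notin> cr_case None" using R(1) x y z t by auto
      have "r_val B q x y t = None" "r_val B q x z t = None"
        using F False c(1) xz by (auto simp: r_val_def cr_case_def)
      then show ?thesis using xz by simp
    qed
  qed
qed

lemma multiplicative_d:
  assumes U: "x \<in> U" "y \<in> U" "u \<in> U" "v \<in> U" "w \<in> U" "z \<in> U" and q: "q \<in> proj_line"
    and ne: "u \<noteq> v" "w \<noteq> z" "B u v \<noteq> q" "q \<noteq> B w z"
  shows "d_defined B q x y u v \<and> d_defined B q u v w z \<and> d_defined B q x y w z \<and>
    d_val B q x y u v * d_val B q u v w z = d_val B q x y w z"
proof -
  obtain x' where x: "x = aff x'" "x' \<in> I" using U(1) by (rule U_cases)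
  obtain y' where y: "y = aff y'" "y' \<in> I" using U(2) by (rule U_cases)
  obtain u' where u: "u = aff u'" "u' \<in> I" using U(3) by (rule U_cases)
  obtain v' where v: "v = aff v'" "v' \<in> I" using U(4) by (rule U_cases)
  obtain w' where w: "w = aff w'" "w' \<in> I" using U(5) by (rule U_cases)
  obtain z' where z: "z = aff z'" "z' \<in> I" using U(6) by (rule U_cases)
  obtain k m where q: "vec k m \<noteq> 0" "q = proj_pt (vec k m)" using proj_line_vec[OF q] by blast
  have n: "u' \<noteq> v'" "w' \<noteq> z'" using ne u v w z by auto
  have L: "m - k * b u' v' \<noteq> 0" "m - k * b w' z' \<noteq> 0"
    using ne(3,4) u v w z aff_eq_proj_pt_iff[OF q(1)] unfolding q(2) by (auto simp: B_aff)
  note d = d_defined_aff[OF _ _ _ _ q(1), folded q(2)]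
  show ?thesis
    unfolding x(1) y(1) u(1) v(1) w(1) z(1)
    using d n L x(2) y(2) u(2) v(2) w(2) z(2) kappa_mult[of x' y' u' v' w' z'] by simp
qed

text \<open>The factor \<open>kappa\<close> does not depend on the index and cancels; what is left
  is the cross-ratio written with the linear forms of \<open>p\<close> and \<open>q\<close>.\<close>

lemma ratio_of_d:
  assumes U: "x \<in> U" "y \<in> U" "u \<in> U" "v \<in> U" and pq: "p \<in> proj_line" "q \<in> proj_line"
    and ne: "x \<noteq> y" "u \<noteq> v" "{B x y, B u v} \<inter> {p, q} = {}"
  shows "d_defined B p x y u v \<and> d_defined B q x y u v \<and> d_val B q x y u v \<noteq> 0 \<and>
    (B x y, B u v, p, q) \<in> cr_dom \<and>
    cross_ratio (B x y, B u v, p, q) = Some (d_val B p x y u v / d_val B q x y u v)"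
proof -
  obtain x' where x: "x = aff x'" "x' \<in> I" using U(1) by (rule U_cases)
  obtain y' where y: "y = aff y'" "y' \<in> I" using U(2) by (rule U_cases)
  obtain u' where u: "u = aff u'" "u' \<in> I" using U(3) by (rule U_cases)
  obtain v' where v: "v = aff v'" "v' \<in> I" using U(4) by (rule U_cases)
  obtain k m where p: "vec k m \<noteq> 0" "p = proj_pt (vec k m)" using proj_line_vec[OF pq(1)] by blast
  obtain l n where q: "vec l n \<noteq> 0" "q = proj_pt (vec l n)" using proj_line_vec[OF pq(2)] by blast
  have ne': "x' \<noteq> y'" "u' \<noteq> v'" using ne x y u v by auto
  have B: "B x y = aff (b x' y')" "B u v = aff (b u' v')" using x y u v by (simp_all add: B_aff)
  have "aff (b x' y') \<noteq> p" "aff (b u' v') \<noteq> p" "aff (b x' y') \<noteq> q" "aff (b u' v') \<noteq> q"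
    using ne(3) unfolding B by auto
  then have L: "m - k * b x' y' \<noteq> 0" "m - k * b u' v' \<noteq> 0" "n - l * b x' y' \<noteq> 0" "n - l * b u' v' \<noteq> 0"
    unfolding p(2) q(2) aff_eq_proj_pt_iff[OF p(1)] aff_eq_proj_pt_iff[OF q(1)] by auto
  note dp = d_defined_aff[OF x(2) y(2) u(2) v(2) p(1) ne'(2) L(2), folded p(2) x(1) y(1) u(1) v(1)]
  note dq = d_defined_aff[OF x(2) y(2) u(2) v(2) q(1) ne'(2) L(4), folded q(2) x(1) y(1) u(1) v(1)]
  have K: "kappa x' y' u' v' \<noteq> 0" using kappa_nz x y u v ne' by simp
  have dom: "(B x y, B u v, p, q) \<in> cr_dom"
    using ne(3) pq unfolding cr_dom_def B by auto
  have "cross_ratio (B x y, B u v, p, q) =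
      Some ((m - k * b x' y') * (n - l * b u' v') / ((n - l * b x' y') * (m - k * b u' v')))"
  proof -
    have d: "(proj_pt (vec 1 (b x' y')), proj_pt (vec 1 (b u' v')), proj_pt (vec k m), proj_pt (vec l n)) \<in> cr_dom"
      using dom unfolding B p q aff_def .
    have nz: "vec 1 (b x' y') \<noteq> 0" "vec 1 (b u' v') \<noteq> 0" by simp_all
    show ?thesis
      using cross_ratio_vec[OF d nz p(1) q(1)] L unfolding B p(2) q(2) aff_def
      by (simp add: mult.commute)
  qed
  also have "\<dots> = Some (d_val B p x y u v / d_val B q x y u v)"
  proof -
    have "\<kappa> * (a' / b') / (\<kappa> * (c' / d')) = a' * d' / (c' * b')" if "\<kappa> \<noteq> 0" for \<kappa> a' b' c' d' :: real
      using that by simp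
    note this[OF K]
    then show ?thesis unfolding dp(2) dq(2) by (simp only:)
  qed
  finally have "cross_ratio (B x y, B u v, p, q) = Some (d_val B p x y u v / d_val B q x y u v)" .
  moreover have "d_val B q x y u v \<noteq> 0" unfolding dq(2) using L K by simp
  ultimately show ?thesis using dp(1) dq(1) dom by blast
qed

end

section \<open>Choice of the basis and proof of the theorem\<close>

lemma plane_basis_exists:
  assumes "dim (UNIV :: 'a::real_vector set) = 2"
  obtains e1 e2 :: "'a::real_vector" where "plane_basis e1 e2"
proof -
  obtain A :: "'a::real_vector set"
    where A: "A \<subseteq> UNIV" "independent A" "UNIV \<subseteq> span A" "card A = dim (UNIV :: 'a set)"
    by (rule basis_exists)
  then have "card A = 2" using assms by simp
  then obtain e1 e2 where e: "A = {e1, e2}" "e1 \<noteq> e2" unfolding card_2_iff by blast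
  have "plane_basis e1 e2"
  proof
    show "lin_indep2 e1 e2" using A(2) e by (simp add: lin_indep2_def)
    fix v :: 'a
    have "v \<in> span {e1, e2}" using A(3) e by blast
    then obtain k where "v - k *\<^sub>R e1 \<in> span {e2}" by (auto simp: span_breakdown_eq)
    then obtain l where "v - k *\<^sub>R e1 = l *\<^sub>R e2" by (auto simp: span_singleton)
    then have "v = k *\<^sub>R e1 + l *\<^sub>R e2" by (simp add: algebra_simps)
    then show "\<exists>x y. v = x *\<^sub>R e1 + y *\<^sub>R e2" by blast
  qed
  then show thesis by (rule that)
qed

theorem theorem6:
  fixes D :: "('a::real_vector set \<times> 'a set) set"
    and B :: "'a set \<Rightarrow> 'a set \<Rightarrow> 'a set"
  assumes dim_E: "dim (UNIV :: 'a set) = 2"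
    and D_nonempty: "D \<noteq> {}"
    and D_open: "openin (prod_topology proj_topology proj_topology) D"
    and B_map: "\<And>p q. (p, q) \<in> D \<Longrightarrow> B p q \<in> proj_line"
    and H1: "\<And>p q. (p, q) \<in> D \<Longrightarrow> (q, p) \<in> D"
    and H2: "\<And>p q r s. (p, q) \<in> D \<Longrightarrow> (r, s) \<in> D \<Longrightarrow> (p, r) \<in> D"
    and H3: "\<And>p q. (p, q) \<in> D \<Longrightarrow> B p q = B q p"
    and H4: "\<And>p q. (p, q) \<in> D \<Longrightarrow> p \<noteq> q \<Longrightarrow> p \<noteq> B p q \<and> B p q \<noteq> q"
    and H5: "\<And>p q r s. (p, q) \<in> D \<Longrightarrow> p \<noteq> q \<Longrightarrow>
        r \<in> proj_topology interior_of (arc_of B p q) \<Longrightarrow>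
        s \<in> proj_topology interior_of (arc_of B p q) \<Longrightarrow> r \<noteq> s \<Longrightarrow>
        (r, s) \<in> D \<and> arc_of B r s \<subseteq> arc_of B p q"
    and H6: "\<And>p q r s. {(p, q), (p, r), (p, s), (q, r), (q, s), (r, s)} \<subseteq> D \<Longrightarrow>
        (B p q, B p r, B p s, B r s) \<in> cr_case (Some 0) \<inter> cr_case None \<Longrightarrow>
        (B p q, B q r, B q s, B r s) \<in> cr_case (Some 0) \<inter> cr_case None \<Longrightarrow>
        cross_ratio (B p q, B p r, B p s, B r s) = cross_ratio (B p q, B q r, B q s, B r s)"
    and H7: "continuous_map (subtopology (prod_topology proj_topology proj_topology) D)
        proj_topology (\<lambda>(p, q). B p q)"
  shows
    "(\<forall>p q. (p, q) \<in> D \<longrightarrow> (p, p) \<in> D \<and> (q, q) \<in> D) \<and>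
     (\<forall>q. (q, q) \<in> D \<longrightarrow> B q q = q) \<and>
     (\<exists>U. U \<noteq> {} \<and> openin proj_topology U \<and> connectedin proj_topology U \<and> D = U \<times> U \<and>
        (\<forall>p\<in>U. \<forall>q\<in>U. p \<noteq> q \<longrightarrow> arc_of B p q \<subseteq> U) \<and>
        (\<forall>p\<in>U. inj_on (B p) U) \<and>
        U \<noteq> proj_line \<and>
        (\<forall>p\<in>U. B p ` U \<subseteq> U \<and> orientation_preserving_on U (B p)) \<and>
        (\<forall>a\<in>U. \<forall>b\<in>U. \<forall>c\<in>U. \<forall>d\<in>U. \<forall>q\<in>proj_line. \<forall>i\<in>{None, Some 0}.
           r_quad B q a b d \<in> cr_case i \<and> r_quad B q b c d \<in> cr_case i \<longrightarrow>
           r_quad B q a c d \<in> cr_case i \<and>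
           rinf_mult (r_val B q a b d) (r_val B q b c d) = r_val B q a c d) \<and>
        (\<forall>x\<in>U. \<forall>y\<in>U. \<forall>u\<in>U. \<forall>v\<in>U. \<forall>w\<in>U. \<forall>z\<in>U. \<forall>q\<in>proj_line.
           u \<noteq> v \<and> w \<noteq> z \<and> B u v \<noteq> q \<and> q \<noteq> B w z \<longrightarrow>
           d_defined B q x y u v \<and> d_defined B q u v w z \<and> d_defined B q x y w z \<and>
           d_val B q x y u v * d_val B q u v w z = d_val B q x y w z) \<and>
        (\<forall>x\<in>U. \<forall>y\<in>U. \<forall>u\<in>U. \<forall>v\<in>U. \<forall>p\<in>proj_line. \<forall>q\<in>proj_line.
           x \<noteq> y \<and> u \<noteq> v \<and> {B x y, B u v} \<inter> {p, q} = {} \<longrightarrow>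
           d_defined B p x y u v \<and> d_defined B q x y u v \<and> d_val B q x y u v \<noteq> 0 \<and>
           (B x y, B u v, p, q) \<in> cr_dom \<and>
           cross_ratio (B x y, B u v, p, q) = Some (d_val B p x y u v / d_val B q x y u v)))"
proof -
  obtain g1 g2 :: 'a where g: "plane_basis g1 g2"
    by (rule plane_basis_exists[OF dim_E])
  have chord: "chord_map e1 e2 D B" if "plane_basis e1 e2" for e1 e2 :: 'a
    by (rule chord_map.intro[OF that], unfold_locales)
      (fact D_nonempty D_open B_map H1 H2 H3 H4 H5 H6 H7)+
  \<comment> \<open>An arbitrary first basis suffices to find a point \<open>p\<close> outside
    \<open>U\<close>; the second basis then puts \<open>p\<close> at infinity. As \<open>U\<close>
    is defined from \<open>D\<close> alone, it is the same set in both.\<close>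
  interpret G: chord_map g1 g2 D B by (rule chord[OF g])
  obtain p where p: "p \<in> proj_line" "p \<notin> G.U"
    using G.U_subset G.U_ne_proj_line by blast
  obtain x y where xy: "G.vec x y \<noteq> 0" "p = proj_pt (G.vec x y)"
    using G.proj_line_vec[OF p(1)] by blast
  have "y * y + x * x \<noteq> 0"
    using xy(1) by (auto simp: sum_squares_eq_zero_iff)
  \<comment> \<open>The vector with coordinates \<open>y\<close> and \<open>- x\<close> is
    independent of the one spanning \<open>p\<close>, because the determinant is
    \<open>y * y + x * x\<close>.\<close>
  then have "lin_indep2 (G.vec y (- x)) (G.vec x y)"
    by (simp add: G.lin_indep2_vec)
  then have basis: "plane_basis (G.vec y (- x)) (G.vec x y)"
    by (rule G.plane_basis_of_indep)
  interpret E: chord_map "G.vec y (- x)" "G.vec x y" D B by (rule chord[OF basis])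
  have pt: "E.pt (pi / 2) = p"
    unfolding E.pt_def E.vec_def by (simp add: xy(2))
  interpret A: chord_map_affine "G.vec y (- x)" "G.vec x y" D B
    by unfold_locales (simp add: p(2) pt)
  show ?thesis
  proof (intro conjI exI[of _ E.U])
    show "\<forall>p q. (p, q) \<in> D \<longrightarrow> (p, p) \<in> D \<and> (q, q) \<in> D" by simp
    show "\<forall>q. (q, q) \<in> D \<longrightarrow> B q q = q" using A.B_diag by simp
    show "\<forall>p\<in>E.U. \<forall>q\<in>E.U. p \<noteq> q \<longrightarrow> arc_of B p q \<subseteq> E.U" using E.arc_subset_U by blast
    show "\<forall>p\<in>E.U. inj_on (B p) E.U" using A.inj_on_B by blast
    show "\<forall>p\<in>E.U. B p ` E.U \<subseteq> E.U \<and> orientation_preserving_on E.U (B p)"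
      using A.B_image A.orientation_B by blast
  qed (intro E.U_nonempty E.openin_U E.connectedin_U E.D_eq E.U_ne_proj_line |
      (intro ballI impI, elim conjE, rule A.multiplicative_r A.multiplicative_d A.ratio_of_d; assumption))+
qed

end
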